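(* Let $X$ be a bounded normal operator on a complex Hilbert space $\mathcal H$ with $\sigma(X)\subseteq\mathcal S=\{z\in\mathbb{C}: -\pi\le\mathrm{Im}(z)\le\pi\}$, and let $Y$ be a bounded operator on $\mathcal H$ with $e^X=e^Y$. (i) If $Y$ is normal and $\sigma(Y)\subseteq\mathcal S$, then $|X|=|Y|$. (ii) In general (for any bounded $Y$), $|X|Y=Y|X|$.
   Context: $|X|=(X^*X)^{1/2}$ denotes the modulus of $X$. *)

theory Defs
  imports "HOL-Analysis.Analysis"
begin

class complex_inner = real_normed_vector +
  fixes cscale :: "complex \<Rightarrow> 'a \<Rightarrow> 'a"
  fixes cinner :: "'a \<Rightarrow> 'a \<Rightarrow> complex"
  assumes cscale_add_right: "cscale a (x + y) = cscale a x + cscale a y"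
    and cscale_add_left: "cscale (a + b) x = cscale a x + cscale b x"
    and cscale_cscale: "cscale a (cscale b x) = cscale (a * b) x"
    and cscale_one: "cscale 1 x = x"
    and scaleR_cscale: "scaleR r x = cscale (complex_of_real r) x"
    and cinner_commute: "cinner x y = cnj (cinner y x)"
    and cinner_add_right: "cinner x (y + z) = cinner x y + cinner x z"
    and cinner_cscale_right: "cinner x (cscale a y) = a * cinner x y"
    and norm_eq_sqrt_cinner: "norm x = sqrt (Re (cinner x x))"

class chilbert_space = complex_inner + complete_space

definition clinear_op :: "('a::complex_inner \<Rightarrow> 'a) \<Rightarrow> bool" where
  "clinear_op T \<longleftrightarrow> (\<forall>x y. T (x + y) = T x + T y) \<and> (\<forall>c x. T (cscale c x) = cscale c (T x))"

definition bounded_op :: "('a::complex_inner \<Rightarrow> 'a) \<Rightarrow> bool" where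
  "bounded_op T \<longleftrightarrow> clinear_op T \<and> (\<exists>K. \<forall>x. norm (T x) \<le> K * norm x)"

definition adjoint :: "('a::complex_inner \<Rightarrow> 'a) \<Rightarrow> ('a \<Rightarrow> 'a)" where
  "adjoint T = (THE S. \<forall>x y. cinner (T x) y = cinner x (S y))"

definition normal_op :: "('a::complex_inner \<Rightarrow> 'a) \<Rightarrow> bool" where
  "normal_op T \<longleftrightarrow> bounded_op T \<and> T \<circ> adjoint T = adjoint T \<circ> T"

definition op_spectrum :: "('a::complex_inner \<Rightarrow> 'a) \<Rightarrow> complex set" where
  "op_spectrum T = {l. \<not> (\<exists>S. bounded_op S \<and>
      S \<circ> (\<lambda>x. T x - cscale l x) = id \<and> (\<lambda>x. T x - cscale l x) \<circ> S = id)}"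

text \<open>Operator exponential e^T = sum_n T^n / n!  (the series converges in operator
  norm for bounded T; we evaluate it pointwise).\<close>
definition op_exp :: "('a::complex_inner \<Rightarrow> 'a) \<Rightarrow> ('a \<Rightarrow> 'a)" where
  "op_exp T = (\<lambda>x. \<Sum>n. scaleR (inverse (fact n)) ((T ^^ n) x))"

definition positive_op :: "('a::complex_inner \<Rightarrow> 'a) \<Rightarrow> bool" where
  "positive_op A \<longleftrightarrow> bounded_op A \<and>
     (\<forall>x. Im (cinner x (A x)) = 0 \<and> 0 \<le> Re (cinner x (A x)))"

definition op_modulus :: "('a::complex_inner \<Rightarrow> 'a) \<Rightarrow> ('a \<Rightarrow> 'a)" where
  "op_modulus X = (THE R. positive_op R \<and> R \<circ> R = adjoint X \<circ> X)"

definition strip_S :: "complex set" where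
  "strip_S = {z. - pi \<le> Im z \<and> Im z \<le> pi}"

end

theory Submission
  imports Defs
begin

text \<open>
  Put \<open>N = e\<^sup>X = e\<^sup>Y\<close>. On the strip, \<open>\<bar>z\<bar>\<^sup>2 = (ln \<bar>w\<bar>)\<^sup>2 + (arccos (Re w / \<bar>w\<bar>))\<^sup>2\<close> is a continuous function
  of \<open>w = e\<^sup>z\<close>, even though the logarithm jumps. Hence \<open>X\<^sup>* X\<close> is a norm limit of polynomials in
  \<open>N\<close> and \<open>N\<^sup>*\<close> that depend on \<open>N\<close> only, which gives (i). Since \<open>Y\<close> commutes with \<open>N\<close>, Fuglede's
  theorem shows that it commutes with \<open>N\<^sup>*\<close>, hence with \<open>X\<^sup>* X\<close> and with its square root.

  The spectral theorem is replaced by approximate eigenvectors: a self-adjoint \<open>T\<close> commuting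
  with a normal \<open>X\<close> has a joint approximate eigenvector with \<open>X\<close> on which \<open>\<parallel>T\<parallel>\<close> is attained. So
  norms of polynomials in operators are bounded by suprema of polynomials over approximate spectra.
\<close>

section \<open>Complex inner product spaces\<close>

\<comment> \<open>The usual proof of Fuglede's theorem applies Liouville's theorem to an
  operator-valued entire function. Here \<open>N\<close> is an exponential, hence invertible, and
  iterated conjugation can take over. Put \<open>T = star N * N\<close> with inverse
  \<open>S\<close>, and let \<open>U\<close> be the unitary product of \<open>star N\<close> with
  the inverse of \<open>N\<close>. Since \<open>Y\<close> commutes with \<open>N\<close>,
  conjugating \<open>Y\<close> by \<open>T\<close> or by \<open>U\<close> gives the same result, so
  the orbit \<open>T ^ n * Y * S ^ n\<close> is bounded, and likewise with \<open>T\<close> and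
  \<open>S\<close> exchanged. On bounded orbits conjugation by a self-adjoint operator does not
  increase norms; as it also fixes \<open>1\<close>, it preserves self-adjointness. For self-adjoint
  \<open>Y\<close> this reads \<open>T * Y * S = S * Y * T\<close>, that is, \<open>Y\<close>
  commutes with \<open>T * T\<close>, and then with its positive root \<open>T\<close>.

  Spectra are never computed. The functional calculus is a relation that mentions \<open>N\<close>
  only, so one operator serves for both logarithms. It needs no more than a compact set that
  contains the approximate eigenvalues of \<open>N\<close> and avoids 0: the image of a disc under
  \<open>exp\<close>.\<close>
subclass (in chilbert_space) banach ..

lemma cscale_zero_left [simp]: "cscale 0 (x::'a::complex_inner) = 0"
  using cscale_add_left[of 0 0 x] by simp

lemma cscale_zero_right [simp]: "cscale a (0::'a::complex_inner) = 0"
  using cscale_add_right[of a 0 0] by simp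

lemma cscale_minus_left: "cscale (- a) (x::'a::complex_inner) = - cscale a x"
  using cscale_add_left[of a "- a" x] by (simp add: eq_neg_iff_add_eq_0 add.commute)

lemma cscale_minus_right: "cscale a (- x::'a::complex_inner) = - cscale a x"
  using cscale_add_right[of a x "- x"] by (simp add: eq_neg_iff_add_eq_0 add.commute)

lemma cscale_diff_left: "cscale (a - b) (x::'a::complex_inner) = cscale a x - cscale b x"
  using cscale_add_left[of a "- b" x] by (simp add: cscale_minus_left)

lemma cscale_diff_right: "cscale a (x - y::'a::complex_inner) = cscale a x - cscale a y"
  using cscale_add_right[of a x "- y"] by (simp add: cscale_minus_right)

lemma cscale_of_real: "cscale (complex_of_real r) (x::'a::complex_inner) = scaleR r x"
  by (simp add: scaleR_cscale)

lemma cinner_add_left: "cinner (x + y) (z::'a::complex_inner) = cinner x z + cinner y z"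
  by (metis cinner_commute cinner_add_right complex_cnj_add)

lemma cinner_cscale_left: "cinner (cscale a x) (y::'a::complex_inner) = cnj a * cinner x y"
  by (metis cinner_commute cinner_cscale_right complex_cnj_mult)

lemma cinner_zero_right [simp]: "cinner x (0::'a::complex_inner) = 0"
  using cinner_add_right[of x 0 0] by simp

lemma cinner_zero_left [simp]: "cinner (0::'a::complex_inner) x = 0"
  using cinner_add_left[of 0 0 x] by simp

lemma cinner_minus_right: "cinner x (- y::'a::complex_inner) = - cinner x y"
  using cinner_add_right[of x y "- y"] by (simp add: eq_neg_iff_add_eq_0 add.commute)

lemma cinner_minus_left: "cinner (- x) (y::'a::complex_inner) = - cinner x y"
  using cinner_add_left[of x "- x" y] by (simp add: eq_neg_iff_add_eq_0 add.commute)

lemma cinner_diff_right: "cinner x (y - z::'a::complex_inner) = cinner x y - cinner x z"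
  using cinner_add_right[of x y "- z"] by (simp add: cinner_minus_right)

lemma cinner_diff_left: "cinner (x - y) (z::'a::complex_inner) = cinner x z - cinner y z"
  using cinner_add_left[of x "- y" z] by (simp add: cinner_minus_left)

lemma cinner_scaleR_right: "cinner x (scaleR r (y::'a::complex_inner)) = of_real r * cinner x y"
  by (simp add: scaleR_cscale cinner_cscale_right)

lemma cinner_scaleR_left: "cinner (scaleR r x) (y::'a::complex_inner) = of_real r * cinner x y"
  by (simp add: scaleR_cscale cinner_cscale_left)

lemmas cinner_simps = cinner_add_left cinner_add_right cinner_diff_left cinner_diff_right
  cinner_cscale_left cinner_cscale_right cinner_scaleR_left cinner_scaleR_right
  cinner_minus_left cinner_minus_right

lemma Re_cinner_self: "Re (cinner x (x::'a::complex_inner)) = (norm x)\<^sup>2"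
proof -
  have "sqrt (Re (cinner x x)) \<ge> 0"
    by (metis norm_eq_sqrt_cinner norm_ge_zero)
  then show ?thesis
    by (simp add: norm_eq_sqrt_cinner[of x])
qed

lemma cinner_self: "cinner x (x::'a::complex_inner) = complex_of_real ((norm x)\<^sup>2)"
proof -
  have "Im (cinner x x) = 0"
    by (metis cinner_commute cnj.simps(2) equal_neg_zero)
  then show ?thesis
    by (intro complex_eqI) (simp_all add: Re_cinner_self del: of_real_power)
qed

lemma Re_cinner_commute: "Re (cinner x (y::'a::complex_inner)) = Re (cinner y x)"
  by (subst cinner_commute) simp

lemma norm_cscale: "norm (cscale a (x::'a::complex_inner)) = cmod a * norm x"
proof -
  have "(norm (cscale a x))\<^sup>2 = Re (cnj a * a * cinner x x)"
    by (simp only: Re_cinner_self[symmetric] cinner_simps mult.assoc mult.left_commute)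
  also have "cnj a * a * cinner x x = complex_of_real ((cmod a * norm x)\<^sup>2)"
    by (simp add: cinner_self power_mult_distrib complex_norm_square mult.commute del: of_real_power)
  finally have "(norm (cscale a x))\<^sup>2 = (cmod a * norm x)\<^sup>2"
    by (simp only: Re_complex_of_real)
  then show ?thesis
    by (simp add: power2_eq_iff_nonneg)
qed

lemma norm_add_square:
  "(norm (x + y::'a::complex_inner))\<^sup>2 = (norm x)\<^sup>2 + 2 * Re (cinner x y) + (norm y)\<^sup>2"
  using Re_cinner_commute[of y x] by (simp add: Re_cinner_self[symmetric] cinner_simps)

lemma norm_diff_square:
  "(norm (x - y::'a::complex_inner))\<^sup>2 = (norm x)\<^sup>2 - 2 * Re (cinner x y) + (norm y)\<^sup>2"
  using Re_cinner_commute[of y x] by (simp add: Re_cinner_self[symmetric] cinner_simps)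

lemma norm_cinner_le: "cmod (cinner x (y::'a::complex_inner)) \<le> norm x * norm y"
proof (cases "cinner x y = 0 \<or> x = 0")
  case True
  then show ?thesis by auto
next
  case False
  define c where "c = cinner x y / of_real ((norm x)\<^sup>2)"
  have nx: "norm x \<noteq> 0" using False by simp
  have cx: "cinner x y = c * of_real ((norm x)\<^sup>2)"
    using nx by (simp add: c_def)
  have "(norm (y - cscale c x))\<^sup>2 = (norm y)\<^sup>2 - 2 * Re (cinner y (cscale c x)) + (norm (cscale c x))\<^sup>2"
    by (rule norm_diff_square)
  also have "Re (cinner y (cscale c x)) = Re (cnj c * cinner x y)"
    by (subst Re_cinner_commute) (simp add: cinner_simps)
  also have "cnj c * cinner x y = of_real ((cmod c)\<^sup>2 * (norm x)\<^sup>2)"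
    unfolding cx of_real_mult complex_norm_square by (simp only: ac_simps)
  finally have "(norm (y - cscale c x))\<^sup>2 = (norm y)\<^sup>2 - (cmod c)\<^sup>2 * (norm x)\<^sup>2"
    by (simp add: norm_cscale power_mult_distrib)
  moreover have "0 \<le> (norm (y - cscale c x))\<^sup>2" by simp
  ultimately have "0 \<le> (norm y)\<^sup>2 - (cmod c)\<^sup>2 * (norm x)\<^sup>2" by simp
  then have "(cmod c * norm x)\<^sup>2 \<le> (norm y)\<^sup>2"
    by (simp add: power_mult_distrib)
  then have "cmod c * norm x \<le> norm y"
    by (simp add: abs_le_square_iff[symmetric])
  then have "cmod c * norm x * norm x \<le> norm y * norm x"
    by (rule mult_right_mono) simp
  moreover have "cmod (cinner x y) = cmod c * norm x * norm x"
    by (simp add: cx norm_mult power2_eq_square)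
  ultimately show ?thesis by (simp add: mult.commute)
qed

lemma cinner_eqI:
  assumes "\<And>x. cinner x y = cinner x (z::'a::complex_inner)"
  shows "y = z"
proof -
  have "cinner (y - z) (y - z) = 0"
    using assms[of "y - z"] by (simp add: cinner_diff_right)
  then show ?thesis by (simp add: cinner_self)
qed

section \<open>Adjoints\<close>

text \<open>Near 0 the linear term dominates and would change sign. This first-order condition
  serves for the Riesz minimiser and again in \<open>orbit_self_adjoint\<close>.\<close>

lemma linear_quadratic_zero:
  fixes a b :: real
  assumes "\<And>t. 0 \<le> a * t + b * t\<^sup>2"
  shows "a = 0"
proof (rule ccontr)
  assume "a \<noteq> 0"
  \<comment> \<open>The denominator exceeds the absolute value of \<open>b\<close>, so the quadratic
    term stays strictly below \<open>- (a * t)\<close>.\<close>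
  define t where "t = - a / (1 + \<bar>b\<bar>)"
  have "b * t\<^sup>2 \<le> \<bar>b\<bar> * t\<^sup>2" by (simp add: mult_right_mono)
  also have "\<dots> = a\<^sup>2 * (\<bar>b\<bar> / (1 + \<bar>b\<bar>)) / (1 + \<bar>b\<bar>)"
    by (simp add: t_def power_divide power2_eq_square)
  also have "\<dots> < a\<^sup>2 * 1 / (1 + \<bar>b\<bar>)"
    using \<open>a \<noteq> 0\<close> by (intro divide_strict_right_mono mult_strict_left_mono) auto
  also have "\<dots> = - (a * t)"
    by (simp add: t_def power2_eq_square)
  finally show False using assms[of t] by simp
qed

text \<open>The representing vector minimises \<open>\<lambda>x. (norm x)\<^sup>2 - 2 * Re (f x)\<close>.\<close>

lemma riesz_representation:
  fixes f :: "'a::chilbert_space \<Rightarrow> complex"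
  assumes add: "\<And>x y. f (x + y) = f x + f y"
    and scale: "\<And>c x. f (cscale c x) = c * f x"
    and bound: "\<And>x. cmod (f x) \<le> K * norm x"
  shows "\<exists>w. \<forall>x. f x = cinner w x"
proof -
  have fR: "f (scaleR r x) = of_real r * f x" for r x
    by (simp add: scaleR_cscale scale)
  define J where "J x = (norm x)\<^sup>2 - 2 * Re (f x)" for x
  have Re_le: "\<bar>Re (f x)\<bar> \<le> K * norm x" for x
    using abs_Re_le_cmod[of "f x"] bound[of x] by linarith
  have lower: "- K\<^sup>2 \<le> J x" for x
  proof -
    have "0 \<le> (norm x - K)\<^sup>2" by simp
    then show ?thesis
      using Re_le[of x] by (auto simp: J_def power2_eq_square algebra_simps)
  qed
  define m where "m = (INF x. J x)"
  have bdd: "bdd_below (range J)"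
    using lower by (intro bdd_belowI[where m = "- K\<^sup>2"]) auto
  have mle: "m \<le> J x" for x
    unfolding m_def by (rule cINF_lower[OF bdd]) simp
  have "\<exists>x. J x < m + 1 / Suc n" for n
    using cINF_less_iff[OF _ bdd, of "m + 1 / Suc n"] by (simp add: m_def)
  then obtain x where x: "\<And>n. J (x n) < m + 1 / Suc n"
    by metis
  \<comment> \<open>Parallelogram law at the midpoint, where the linear terms of \<open>J\<close>
    cancel; it turns almost minimality into the Cauchy property.\<close>
  have par: "(norm (u - v))\<^sup>2 \<le> 2 * (J u - m) + 2 * (J v - m)" for u v
  proof -
    have "J u + J v - 2 * J (scaleR (1/2) (u + v)) = (norm (u - v))\<^sup>2 / 2"
      by (simp add: J_def norm_diff_square norm_add_square fR add cinner_simps power_mult_distrib field_simps)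
    then show ?thesis using mle[of "scaleR (1/2) (u + v)"] by simp
  qed
  have "Cauchy x"
  proof (rule metric_CauchyI)
    fix e :: real assume "0 < e"
    then obtain N where N: "4 / e\<^sup>2 < real N"
      using reals_Archimedean2 by blast
    have "dist (x i) (x j) < e" if "N \<le> i" "N \<le> j" for i j
    proof -
      have "0 < 4 / e\<^sup>2" using \<open>0 < e\<close> by simp
      then have "0 < real N" using N by linarith
      have le: "1 / Suc k \<le> 1 / N" if "N \<le> k" for k
        using that \<open>0 < real N\<close> by (intro divide_left_mono) auto
      have "(norm (x i - x j))\<^sup>2 < 4 / N"
        using par[of "x i" "x j"] x[of i] x[of j] le[of i] le[of j] that by simp
      also have "4 / N < e\<^sup>2"
        using N \<open>0 < e\<close> \<open>0 < real N\<close> by (simp add: field_simps)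
      finally show ?thesis
        using \<open>0 < e\<close> by (simp add: dist_norm power2_less_imp_less)
    qed
    then show "\<exists>N. \<forall>i\<ge>N. \<forall>j\<ge>N. dist (x i) (x j) < e" by blast
  qed
  then obtain w where w: "x \<longlonglongrightarrow> w"
    using Cauchy_convergent convergent_def by blast
  have "bounded_linear f"
    using add fR bound by (intro bounded_linear_intro[where K = K]) (auto simp: scaleR_conv_of_real mult.commute)
  then have "(\<lambda>n. J (x n)) \<longlonglongrightarrow> J w"
    unfolding J_def using w by (intro tendsto_intros) (auto intro: bounded_linear.tendsto)
  moreover have "(\<lambda>n. m + 1 / Suc n) \<longlonglongrightarrow> m + 0"
    by (intro tendsto_add tendsto_const LIMSEQ_Suc[OF lim_1_over_n])
  ultimately have "J w \<le> m"
    using x by (intro LIMSEQ_le[of "\<lambda>n. J (x n)" _ "\<lambda>n. m + 1 / Suc n"]) (auto intro: less_imp_le)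
  have Re_eq: "Re (f h) = Re (cinner w h)" for h
  proof -
    have "0 \<le> 2 * (Re (cinner w h) - Re (f h)) * t + (norm h)\<^sup>2 * t\<^sup>2" for t
    proof -
      have "J (w + scaleR t h) = J w + 2 * (Re (cinner w h) - Re (f h)) * t + (norm h)\<^sup>2 * t\<^sup>2"
        by (simp add: J_def norm_add_square add fR cinner_simps power_mult_distrib algebra_simps)
      then show ?thesis using mle[of "w + scaleR t h"] \<open>J w \<le> m\<close> by linarith
    qed
    from linear_quadratic_zero[OF this] show ?thesis by simp
  qed
  have "f h = cinner w h" for h
  proof (rule complex_eqI)
    \<comment> \<open>Multiplication by \<open>- \<i>\<close> moves the imaginary part into the real
      part.\<close>
    show "Im (f h) = Im (cinner w h)"
      using Re_eq[of "cscale (- \<i>) h"] by (simp add: scale cinner_simps)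
  qed (rule Re_eq)
  then show ?thesis by blast
qed

lemma adjoint_exists:
  fixes T :: "'a::chilbert_space \<Rightarrow> 'a"
  assumes "bounded_op T"
  shows "\<exists>S. \<forall>x y. cinner (T x) y = cinner x (S y)"
proof -
  obtain K where K: "\<And>x. norm (T x) \<le> K * norm x"
    using assms by (auto simp: bounded_op_def)
  have "\<exists>w. \<forall>x. cinner y (T x) = cinner w x" for y
  proof (rule riesz_representation)
    show "cmod (cinner y (T x)) \<le> (norm y * K) * norm x" for x
      using norm_cinner_le[of y "T x"] mult_left_mono[OF K[of x], of "norm y"] by (simp add: mult.assoc)
  qed (use assms in \<open>auto simp: bounded_op_def clinear_op_def cinner_simps\<close>)
  then obtain S where "\<And>x y. cinner y (T x) = cinner (S y) x" by metis
  then show ?thesis by (metis cinner_commute)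
qed

lemma adjoint_eqI:
  assumes "\<And>x y. cinner (T x) y = cinner x (S (y::'a::complex_inner))"
  shows "adjoint T = S"
  unfolding adjoint_def using assms by (intro the_equality) (auto intro!: ext intro: cinner_eqI)

lemma cinner_adjoint:
  fixes T :: "'a::chilbert_space \<Rightarrow> 'a"
  assumes "bounded_op T"
  shows "cinner (T x) y = cinner x (adjoint T y)"
  using adjoint_exists[OF assms] adjoint_eqI by metis

lemma bounded_op_adjoint:
  fixes T :: "'a::chilbert_space \<Rightarrow> 'a"
  assumes "bounded_op T"
  shows "bounded_op (adjoint T)"
proof -
  obtain K where K: "\<And>x. norm (T x) \<le> K * norm x"
    using assms by (auto simp: bounded_op_def)
  note adj = cinner_adjoint[OF assms, symmetric]
  have "norm (adjoint T y) \<le> K * norm y" for y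
  proof (cases "adjoint T y = 0")
    case True
    have "0 \<le> K * norm y"
      using K[of y] norm_ge_zero order_trans by blast
    then show ?thesis using True by simp
  next
    case False
    have "norm (adjoint T y) * norm (adjoint T y) = cmod (cinner (adjoint T y) (adjoint T y))"
      unfolding cinner_self norm_of_real by (simp add: power2_eq_square)
    also have "\<dots> \<le> norm (T (adjoint T y)) * norm y"
      unfolding adj by (rule norm_cinner_le)
    also have "\<dots> \<le> (K * norm (adjoint T y)) * norm y"
      by (intro mult_right_mono K) simp
    finally show ?thesis using False by (simp add: mult.commute mult.left_commute)
  qed
  moreover have "clinear_op (adjoint T)"
    unfolding clinear_op_def
    by (intro conjI allI; rule cinner_eqI; simp only: cinner_simps adj)
  ultimately show ?thesis by (auto simp: bounded_op_def)
qed

section \<open>The algebra of bounded operators\<close>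

text \<open>Operators become elements of a Banach algebra type, so that powers, limits and series
  are those of the type classes. Complex linearity is a closed condition inside the real-linear
  maps.\<close>

typedef (overloaded) 'a bop =
  "{L :: 'a::chilbert_space \<Rightarrow>\<^sub>L 'a. \<forall>c x. blinfun_apply L (cscale c x) = cscale c (blinfun_apply L x)}"
  morphisms blinfun_of_bop Abs_bop
  by (rule exI[where x = 0]) simp

setup_lifting type_definition_bop

lift_definition ap :: "'a::chilbert_space bop \<Rightarrow> 'a \<Rightarrow> 'a" is blinfun_apply .

lemma bop_eqI: "(\<And>x. ap S x = ap T x) \<Longrightarrow> S = T"
  by transfer (rule blinfun_eqI)

instantiation bop :: (chilbert_space) real_normed_vector
begin

lift_definition zero_bop :: "'a bop" is 0 by simp
lift_definition plus_bop :: "'a bop \<Rightarrow> 'a bop \<Rightarrow> 'a bop" is "(+)"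
  by (simp add: blinfun.add_left cscale_add_right)
lift_definition minus_bop :: "'a bop \<Rightarrow> 'a bop \<Rightarrow> 'a bop" is "(-)"
  by (simp add: blinfun.diff_left cscale_diff_right)
lift_definition uminus_bop :: "'a bop \<Rightarrow> 'a bop" is uminus
  by (simp add: blinfun.minus_left cscale_minus_right)
lift_definition scaleR_bop :: "real \<Rightarrow> 'a bop \<Rightarrow> 'a bop" is scaleR
  by (simp add: blinfun.scaleR_left scaleR_cscale cscale_cscale mult.commute)
lift_definition norm_bop :: "'a bop \<Rightarrow> real" is norm .
definition dist_bop :: "'a bop \<Rightarrow> 'a bop \<Rightarrow> real" where
  "dist_bop S T = norm (S - T)"
definition sgn_bop :: "'a bop \<Rightarrow> 'a bop" where
  "sgn_bop T = inverse (norm T) *\<^sub>R T"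
definition uniformity_bop :: "('a bop \<times> 'a bop) filter" where
  "uniformity_bop = (INF e\<in>{0 <..}. principal {(x, y). dist x y < e})"
definition open_bop :: "'a bop set \<Rightarrow> bool" where
  "open_bop U = (\<forall>x\<in>U. eventually (\<lambda>(x', y). x' = x \<longrightarrow> y \<in> U) uniformity)"

instance
proof
  fix S T V :: "'a bop" and a b :: real and U :: "'a bop set"
  show "S + T + V = S + (T + V)" "S + T = T + S" "0 + S = S" "- S + S = 0" "S - T = S + - T"
    by (transfer; simp)+
  show "a *\<^sub>R (S + T) = a *\<^sub>R S + a *\<^sub>R T" "(a + b) *\<^sub>R S = a *\<^sub>R S + b *\<^sub>R S"
    "a *\<^sub>R b *\<^sub>R S = (a * b) *\<^sub>R S" "1 *\<^sub>R S = S"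
    by (transfer; simp add: algebra_simps)+
  show "norm S = 0 \<longleftrightarrow> S = 0" "norm (a *\<^sub>R S) = \<bar>a\<bar> * norm S"
    by (transfer; simp)+
  show "norm (S + T) \<le> norm S + norm T"
    by transfer (rule norm_triangle_ineq)
qed (simp_all add: dist_bop_def sgn_bop_def uniformity_bop_def open_bop_def)

end

instantiation bop :: (chilbert_space) "{real_normed_algebra, monoid_mult}"
begin

lift_definition one_bop :: "'a bop" is id_blinfun by simp
lift_definition times_bop :: "'a bop \<Rightarrow> 'a bop \<Rightarrow> 'a bop" is blinfun_compose by simp

instance
proof
  fix S T V :: "'a bop" and a :: real
  show "S * T * V = S * (T * V)" "(S + T) * V = S * V + T * V" "S * (T + V) = S * T + S * V"
    "1 * S = S" "S * 1 = S" "(a *\<^sub>R S) * T = a *\<^sub>R (S * T)" "S * (a *\<^sub>R T) = a *\<^sub>R (S * T)"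
    by (transfer; rule blinfun_eqI; simp add: blinfun.bilinear_simps)+
  show "norm (S * T) \<le> norm S * norm T"
    by transfer (rule norm_blinfun_compose)
qed

end

lemma ap_simps [simp]:
  "ap 0 x = 0" "ap 1 x = x" "ap (S + T) x = ap S x + ap T x" "ap (S - T) x = ap S x - ap T x"
  "ap (- S) x = - ap S x" "ap (r *\<^sub>R S) x = r *\<^sub>R ap S x" "ap (S * T) x = ap S (ap T x)"
  by (transfer; simp add: blinfun.bilinear_simps)+

lemma ap_linear [simp]:
  "ap S 0 = 0" "ap S (x + y) = ap S x + ap S y" "ap S (x - y) = ap S x - ap S y"
  "ap S (- x) = - ap S x" "ap S (r *\<^sub>R x) = r *\<^sub>R ap S x" "ap S (cscale c x) = cscale c (ap S x)"
  by (transfer; simp add: blinfun.bilinear_simps)+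

lemma norm_ap: "norm (ap T x) \<le> norm T * norm x"
  by transfer (rule norm_blinfun)

lemma norm_bop_le: "0 \<le> b \<Longrightarrow> (\<And>x. norm (ap T x) \<le> b * norm x) \<Longrightarrow> norm T \<le> b"
  by transfer (rule norm_blinfun_bound)

lemma norm_one_bop_le: "norm (1 :: 'a::chilbert_space bop) \<le> 1"
  by (rule norm_bop_le) auto

lemma bounded_bilinear_ap: "bounded_bilinear ap"
  by (rule bounded_bilinear.intro) (auto intro!: exI[where x = 1] norm_ap)

lemmas tendsto_ap = bounded_bilinear.tendsto[OF bounded_bilinear_ap]

instance bop :: (chilbert_space) banach
proof
  fix T :: "nat \<Rightarrow> 'a bop"
  assume "Cauchy T"
  have iso: "dist (blinfun_of_bop A) (blinfun_of_bop B) = dist A B" for A B :: "'a bop"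
    unfolding dist_norm by transfer simp
  from \<open>Cauchy T\<close> have "Cauchy (\<lambda>n. blinfun_of_bop (T n))"
    by (simp add: Cauchy_def iso)
  then obtain L where L: "(\<lambda>n. blinfun_of_bop (T n)) \<longlonglongrightarrow> L"
    using Cauchy_convergent convergent_def by blast
  have lim: "(\<lambda>n. ap (T n) x) \<longlonglongrightarrow> blinfun_apply L x" for x
    unfolding ap.rep_eq by (intro blinfun.tendsto L tendsto_const)
  have "blinfun_apply L (cscale c x) = cscale c (blinfun_apply L x)" for c x
  proof (rule LIMSEQ_unique[OF lim])
    have "bounded_linear (cscale c :: 'a \<Rightarrow> 'a)"
      by (rule bounded_linear_intro[where K = "cmod c"])
        (auto simp: cscale_add_right scaleR_cscale cscale_cscale norm_cscale mult.commute)
    from bounded_linear.tendsto[OF this lim[of x]]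
    show "(\<lambda>n. ap (T n) (cscale c x)) \<longlonglongrightarrow> cscale c (blinfun_apply L x)" by simp
  qed
  then have "L = blinfun_of_bop (Abs_bop L)"
    by (simp add: Abs_bop_inverse)
  with L have "(\<lambda>n. blinfun_of_bop (T n)) \<longlonglongrightarrow> blinfun_of_bop (Abs_bop L)" by simp
  then have "T \<longlonglongrightarrow> Abs_bop L"
    by (simp add: lim_sequentially iso)
  then show "convergent T" by (auto simp: convergent_def)
qed

lemma bounded_op_ap: "bounded_op (ap T)"
  unfolding bounded_op_def clinear_op_def using norm_ap by auto

lemma bounded_op_cases:
  assumes "bounded_op f"
  obtains T where "f = ap T"
proof -
  obtain K where K: "\<And>x. norm (f x) \<le> K * norm x"
    using assms by (auto simp: bounded_op_def)
  have "bounded_linear f"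
    using assms K by (intro bounded_linear_intro[where K = K])
      (auto simp: bounded_op_def clinear_op_def scaleR_cscale mult.commute)
  then have "f = ap (Abs_bop (Blinfun f))"
    using assms by (auto simp: ap.rep_eq Abs_bop_inverse bounded_linear_Blinfun_apply
        bounded_op_def clinear_op_def)
  then show thesis by (rule that)
qed

text \<open>The algebra carries real scalars only; complex ones enter as central operators.\<close>

definition scal :: "complex \<Rightarrow> 'a::chilbert_space bop" where
  "scal c = (SOME T. ap T = cscale c)"

lemma ap_scal [simp]: "ap (scal c) x = cscale c x"
proof -
  have "bounded_op (cscale c :: 'a \<Rightarrow> 'a)"
    unfolding bounded_op_def clinear_op_def
    by (auto simp: cscale_add_right cscale_cscale norm_cscale mult.commute intro!: exI[where x = "cmod c"])
  then have "\<exists>T. ap T = (cscale c :: 'a \<Rightarrow> 'a)"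
    by (metis bounded_op_cases)
  then have "ap (scal c) = (cscale c :: 'a \<Rightarrow> 'a)"
    unfolding scal_def by (rule someI_ex)
  then show ?thesis by simp
qed

lemma scal_simps:
  "scal 0 = 0" "scal 1 = 1" "scal (a + b) = scal a + scal b" "scal (a - b) = scal a - scal b"
  "scal (a * b) = scal a * scal b" "scal (- a) = - scal a" "scal (complex_of_real r) = r *\<^sub>R 1"
  by (rule bop_eqI; simp add: cscale_one cscale_add_left cscale_diff_left cscale_cscale mult.commute
      cscale_minus_left cscale_of_real)+

lemma scal_commute: "T * scal c = scal c * T"
  by (rule bop_eqI) simp

lemma norm_scal_le: "norm (scal c) \<le> cmod c"
  by (rule norm_bop_le) (auto simp: norm_cscale)

section \<open>The involution and the C*-identity\<close>

definition star :: "'a::chilbert_space bop \<Rightarrow> 'a bop" where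
  "star T = (SOME S. ap S = adjoint (ap T))"

lemma ap_star: "ap (star T) = adjoint (ap T)"
proof -
  have "\<exists>S. ap S = adjoint (ap T)"
    by (metis bounded_op_cases bounded_op_adjoint bounded_op_ap)
  then show ?thesis unfolding star_def by (rule someI_ex)
qed

lemma cinner_star: "cinner x (ap (star T) y) = cinner (ap T x) y"
  by (simp add: ap_star cinner_adjoint bounded_op_ap)

lemma cinner_star_left: "cinner (ap (star T) x) y = cinner x (ap T y)"
  by (metis cinner_commute cinner_star)

lemma star_eqI: "(\<And>x y. cinner (ap T x) y = cinner x (ap S y)) \<Longrightarrow> star T = S"
  by (rule bop_eqI) (simp add: ap_star adjoint_eqI)

lemma star_simps [simp]:
  "star (star T) = T" "star 0 = 0" "star 1 = 1" "star (S + T) = star S + star T"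
  "star (S - T) = star S - star T" "star (- T) = - star T"
  "star (r *\<^sub>R T) = r *\<^sub>R star T" "star (S * T) = star T * star S" "star (scal c) = scal (cnj c)"
  by (rule star_eqI; simp add: cinner_simps cinner_star cinner_star_left)+

lemma star_power: "star (T ^ n) = star T ^ n"
  by (induction n) (simp_all add: power_commutes)

lemma norm_ap_square: "(norm (ap T x))\<^sup>2 = Re (cinner x (ap (star T * T) x))"
  by (simp add: Re_cinner_self[symmetric] cinner_star)

lemma Re_cinner_ap_le: "\<bar>Re (cinner x (ap T x))\<bar> \<le> norm T * (norm x)\<^sup>2"
proof -
  have "\<bar>Re (cinner x (ap T x))\<bar> \<le> norm x * norm (ap T x)"
    using abs_Re_le_cmod norm_cinner_le order_trans by blast
  also have "\<dots> \<le> norm x * (norm T * norm x)"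
    by (intro mult_left_mono norm_ap) simp
  finally show ?thesis by (simp add: power2_eq_square ac_simps)
qed

text \<open>Cauchy-Schwarz for the quadratic form of \<open>star T * T\<close>. This is the half of
  the C*-identity with content; the other half is submultiplicativity together with
  \<open>norm_star\<close>.\<close>

lemma norm_square_le_norm_star_mult: "(norm T)\<^sup>2 \<le> norm (star T * T)"
proof -
  have "norm T \<le> sqrt (norm (star T * T))"
  proof (rule norm_bop_le)
    fix x
    have "(norm (ap T x))\<^sup>2 \<le> norm (star T * T) * (norm x)\<^sup>2"
      unfolding norm_ap_square using Re_cinner_ap_le abs_le_D1 by blast
    then have "norm (ap T x) \<le> sqrt (norm (star T * T) * (norm x)\<^sup>2)"
      by (simp add: real_le_rsqrt)
    then show "norm (ap T x) \<le> sqrt (norm (star T * T)) * norm x"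
      by (simp add: real_sqrt_mult)
  qed simp
  then have "(norm T)\<^sup>2 \<le> (sqrt (norm (star T * T)))\<^sup>2"
    by (rule power_mono) simp
  then show ?thesis by simp
qed

lemma norm_star [simp]: "norm (star T) = norm T"
proof -
  have le: "norm S \<le> norm (star S)" for S :: "'a bop"
  proof (cases "S = 0")
    case False
    have "norm S * norm S \<le> norm (star S) * norm S"
      using norm_square_le_norm_star_mult[of S] norm_mult_ineq[of "star S" S]
      by (simp add: power2_eq_square)
    then show ?thesis using False by simp
  qed simp
  show ?thesis using le[of T] le[of "star T"] by simp
qed

lemma norm_star_mult: "norm (star T * T) = (norm T)\<^sup>2"
  using norm_square_le_norm_star_mult[of T] norm_mult_ineq[of "star T" T]
  by (simp add: power2_eq_square)

text \<open>The C*-identity iterated by squaring. It stands in for the spectral radius formula,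
  which explains the exponents \<open>2 ^ k\<close> from here on.\<close>

lemma norm_self_adjoint_power:
  assumes "star P = P"
  shows "norm (P ^ 2 ^ k) = norm P ^ 2 ^ k"
proof (induction k)
  case (Suc k)
  have "P ^ 2 ^ Suc k = star (P ^ 2 ^ k) * P ^ 2 ^ k"
    by (simp add: star_power assms power_add[symmetric] mult_2)
  then show ?case
    by (simp only: norm_star_mult Suc power_mult[symmetric] power_Suc2)
qed simp

lemma bounded_linear_star: "bounded_linear star"
  by (rule bounded_linear_intro[where K = 1]) auto

lemma commute_limit:
  fixes F :: "nat \<Rightarrow> 'a::chilbert_space bop"
  assumes "F \<longlonglongrightarrow> A" and "\<And>n. W * F n = F n * W"
  shows "W * A = A * W"
proof (rule LIMSEQ_unique)
  show "(\<lambda>n. W * F n) \<longlonglongrightarrow> W * A" by (intro tendsto_intros assms)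
  show "(\<lambda>n. W * F n) \<longlonglongrightarrow> A * W" unfolding assms(2) by (intro tendsto_intros assms)
qed

text \<open>Polarisation with \<open>x + y\<close> and \<open>x + \<i> y\<close>. Complex scalars
  are essential: a real rotation by a right angle has zero quadratic form.\<close>

lemma cinner_zero_imp_zero:
  assumes "\<And>x. cinner x (ap B x) = 0"
  shows "B = 0"
proof (rule bop_eqI, rule cinner_eqI)
  fix x y
  have "cinner y (ap B x) + cinner x (ap B y) = 0"
    using assms[of "x + y"] assms[of x] assms[of y] by (simp add: cinner_simps add.commute)
  moreover have "cinner y (ap B x) - cinner x (ap B y) = 0"
    using assms[of "x + cscale \<i> y"] assms[of x] assms[of y]
    by (simp add: cinner_simps)
  ultimately show "cinner y (ap B x) = cinner y (ap 0 x)" by simp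
qed

lemma self_adjointI:
  assumes "\<And>x. Im (cinner x (ap B x)) = 0"
  shows "star B = B"
proof -
  have "cinner x (ap (star B - B) x) = 0" for x
  proof -
    have "cinner x (ap (star B) x) = cnj (cinner x (ap B x))"
      by (simp add: cinner_star flip: cinner_commute)
    then show ?thesis using assms[of x] by (simp add: cinner_simps complex_eq_iff)
  qed
  then have "star B - B = 0" by (rule cinner_zero_imp_zero)
  then show ?thesis by simp
qed

section \<open>Joint approximate eigenvectors\<close>

definition joint :: "'a::chilbert_space bop set \<Rightarrow> bool" where
  "joint \<D> \<longleftrightarrow> (\<forall>e>0. \<exists>u. norm u = 1 \<and> (\<forall>D\<in>\<D>. norm (ap D u) < e))"

text \<open>The number \<open>M\<close> is the asymptotic supremum of the quadratic form of \<open>A\<close> over the approximate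
  kernel of \<open>\<D>\<close>. If \<open>P = M - A\<close> did not almost annihilate an almost maximal \<open>u\<close>, the vector
  \<open>u - s P u\<close>, which is again almost annihilated by \<open>\<D>\<close>, would exceed the supremum.\<close>

lemma joint_extremal:
  assumes sa: "star A = A"
    and comm: "\<And>D. D \<in> \<D> \<Longrightarrow> D * A = A * D"
    and ex: "\<And>e. 0 < e \<Longrightarrow>
      \<exists>u. norm u = 1 \<and> (\<forall>D\<in>\<D>. norm (ap D u) < e) \<and> c \<le> Re (cinner u (ap A u))"
  shows "\<exists>M\<ge>c. joint (insert (A - M *\<^sub>R 1) \<D>)"
proof -
  define q where "q u = Re (cinner u (ap A u))" for u
  have q_scale: "q (r *\<^sub>R u) = r\<^sup>2 * q u" for r u
    by (simp add: q_def cinner_simps power2_eq_square)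
  define S where "S = {m. \<forall>e>0. \<exists>u. norm u = 1 \<and> (\<forall>D\<in>\<D>. norm (ap D u) < e) \<and> m \<le> q u}"
  define M where "M = Sup S"
  have "c \<in> S" using ex by (auto simp: S_def q_def)
  have "m \<le> norm A" if "m \<in> S" for m
  proof -
    have "\<forall>e>0. \<exists>u. norm u = 1 \<and> (\<forall>D\<in>\<D>. norm (ap D u) < e) \<and> m \<le> q u"
      using that by (simp add: S_def)
    from this[rule_format, OF zero_less_one] obtain u where "norm u = 1" "m \<le> q u" by blast
    then show ?thesis using Re_cinner_ap_le[of u A] by (simp add: q_def)
  qed
  then have bdd: "bdd_above S" by (rule bdd_aboveI)
  have "c \<le> M" unfolding M_def by (rule cSup_upper[OF \<open>c \<in> S\<close> bdd])
  define P where "P = M *\<^sub>R 1 - A"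
  define p where "p = norm P"
  have "0 \<le> p" by (simp add: p_def)
  have saP: "star P = P" by (simp add: P_def sa)
  have qP: "Re (cinner u (ap P u)) = M * (norm u)\<^sup>2 - q u" for u
    by (simp add: P_def q_def cinner_simps Re_cinner_self)
  have commP: "ap D (ap P u) = ap P (ap D u)" if "D \<in> \<D>" for D u
  proof -
    have "ap (D * A) u = ap (A * D) u" using comm[OF that] by simp
    then show ?thesis by (simp add: P_def)
  qed
  have "\<exists>u. norm u = 1 \<and> (\<forall>D\<in>insert (A - M *\<^sub>R 1) \<D>. norm (ap D u) < e)" if "0 < e" for e
  proof -
    \<comment> \<open>Chosen so that the final bound \<open>5 * \<eta> * (p + 1)\<close> equals half
      of \<open>e\<^sup>2\<close>.\<close>
    define \<eta> where "\<eta> = e\<^sup>2 / (10 * (p + 1))"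
    have "0 < \<eta>" using \<open>0 < e\<close> \<open>0 \<le> p\<close> by (simp add: \<eta>_def)
    have "M + \<eta> \<notin> S"
      using cSup_upper[OF _ bdd, of "M + \<eta>"] \<open>0 < \<eta>\<close> by (auto simp: M_def)
    then obtain \<delta> where "0 < \<delta>"
      and \<delta>: "\<And>u. norm u = 1 \<Longrightarrow> (\<forall>D\<in>\<D>. norm (ap D u) < \<delta>) \<Longrightarrow> q u < M + \<eta>"
      unfolding S_def by (auto simp: not_le) (meson not_le)
    \<comment> \<open>This step length gives \<open>s * p = 1 - s\<close>: then \<open>y\<close>
      below has norm at least \<open>s\<close>, and the term with \<open>s\<^sup>2\<close> absorbs
      at most half of the decrease.\<close>
    define s where "s = 1 / (p + 1)"
    have s: "0 < s" "s \<le> 1" "s * p \<le> 1" "s * p = 1 - s"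
      using \<open>0 \<le> p\<close> by (auto simp: s_def field_simps)
    obtain m where "m \<in> S" "M - \<eta> < m"
      using less_cSupE[of "M - \<eta>" S] \<open>0 < \<eta>\<close> \<open>c \<in> S\<close> by (auto simp: M_def)
    \<comment> \<open>Passing from \<open>u\<close> to \<open>y\<close> costs a factor 2,
      normalising \<open>y\<close> a factor \<open>1 / s\<close>; this leaves exactly
      \<open>\<delta>\<close>.\<close>
    moreover have "0 < min (\<delta> * s / 2) e" using \<open>0 < \<delta>\<close> s \<open>0 < e\<close> by simp
    ultimately obtain u where u: "norm u = 1"
      and uD: "\<And>D. D \<in> \<D> \<Longrightarrow> norm (ap D u) < min (\<delta> * s / 2) e" and "m \<le> q u"
      unfolding S_def by blast
    define y where "y = u - s *\<^sub>R ap P u"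
    have nP: "norm (ap P v) \<le> p * norm v" for v
      unfolding p_def by (rule norm_ap)
    have "norm (s *\<^sub>R ap P u) \<le> 1 - s"
      using nP[of u] s u mult_left_mono[of "norm (ap P u)" p s] by simp
    then have y_lower: "s \<le> norm y"
      using norm_triangle_ineq2[of u "s *\<^sub>R ap P u"] u by (simp add: y_def)
    have y_upper: "norm y \<le> 2"
      using norm_triangle_ineq4[of u "s *\<^sub>R ap P u"] u \<open>norm (s *\<^sub>R ap P u) \<le> 1 - s\<close> s
      by (simp add: y_def)
    define v where "v = (1 / norm y) *\<^sub>R y"
    have "norm v = 1" using y_lower s by (auto simp: v_def)
    moreover have "norm (ap D v) < \<delta>" if "D \<in> \<D>" for D
    proof -
      have "ap D y = ap D u - s *\<^sub>R ap P (ap D u)"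
        by (simp add: y_def commP[OF that])
      then have "norm (ap D y) \<le> norm (ap D u) + s * norm (ap P (ap D u))"
        using norm_triangle_ineq4[of "ap D u" "s *\<^sub>R ap P (ap D u)"] s by simp
      also have "\<dots> \<le> norm (ap D u) + s * (p * norm (ap D u))"
        using s by (intro add_left_mono mult_left_mono nP) auto
      also have "\<dots> \<le> 2 * norm (ap D u)"
        using mult_right_mono[OF s(3), of "norm (ap D u)"] by simp
      also have "\<dots> < \<delta> * s" using uD[OF that] by simp
      also have "\<dots> \<le> \<delta> * norm y" using y_lower \<open>0 < \<delta>\<close> by simp
      finally show ?thesis using y_lower s \<open>0 < \<delta>\<close> by (simp add: v_def divide_simps)
    qed
    ultimately have "q v < M + \<eta>" using \<delta> by blast
    moreover have "y = norm y *\<^sub>R v" using y_lower s by (auto simp: v_def)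
    then have "q y = (norm y)\<^sup>2 * q v"
      using q_scale by metis
    ultimately have "q y \<le> (norm y)\<^sup>2 * (M + \<eta>)"
      by (simp add: mult_left_mono)
    then have "- ((norm y)\<^sup>2 * \<eta>) \<le> Re (cinner y (ap P y))"
      unfolding qP by (simp add: algebra_simps)
    moreover have "(norm y)\<^sup>2 * \<eta> \<le> 2\<^sup>2 * \<eta>"
      using y_upper \<open>0 < \<eta>\<close> by (intro mult_right_mono power_mono) auto
    ultimately have low: "- 4 * \<eta> \<le> Re (cinner y (ap P y))" by simp
    \<comment> \<open>Since \<open>y\<close> is nearly killed by \<open>\<D>\<close>, its form
      cannot fall below \<open>- 4 * \<eta>\<close>; the expansion bounds it above by
      \<open>\<eta> - s * (norm (ap P u))\<^sup>2\<close>. Together they force \<open>ap P u\<close>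
      to be small.\<close>
    have "Re (cinner y (ap P y)) = Re (cinner u (ap P u)) - 2 * s * (norm (ap P u))\<^sup>2
        + s\<^sup>2 * Re (cinner (ap P u) (ap P (ap P u)))"
    proof -
      have "cinner u (ap P (ap P u)) = cinner (ap P u) (ap P u)"
        by (metis cinner_star saP)
      then show ?thesis
        by (simp add: y_def cinner_simps Re_cinner_self power2_eq_square algebra_simps)
    qed
    also have "\<dots> \<le> \<eta> - 2 * s * (norm (ap P u))\<^sup>2 + s * (norm (ap P u))\<^sup>2"
    proof -
      have "s\<^sup>2 * Re (cinner (ap P u) (ap P (ap P u))) \<le> s\<^sup>2 * (p * (norm (ap P u))\<^sup>2)"
        using Re_cinner_ap_le[of "ap P u" P] by (intro mult_left_mono) (auto simp: p_def)
      also have "\<dots> = s * ((s * p) * (norm (ap P u))\<^sup>2)" by (simp add: power2_eq_square)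
      also have "\<dots> \<le> s * (1 * (norm (ap P u))\<^sup>2)"
        using s by (intro mult_left_mono mult_right_mono) auto
      finally show ?thesis
        using qP[of u] u \<open>m \<le> q u\<close> \<open>M - \<eta> < m\<close> by simp
    qed
    finally have "s * (norm (ap P u))\<^sup>2 \<le> 5 * \<eta>" using low by simp
    then have "(norm (ap P u))\<^sup>2 \<le> 5 * \<eta> * (p + 1)"
      using \<open>0 \<le> p\<close> by (simp add: s_def field_simps)
    also have "\<dots> = e\<^sup>2 / 2" using \<open>0 \<le> p\<close> by (simp add: \<eta>_def field_simps)
    also have "\<dots> < e\<^sup>2" using \<open>0 < e\<close> by simp
    finally have "norm (ap P u) < e" using \<open>0 < e\<close> by (simp add: power2_less_imp_less)
    moreover have "ap (A - M *\<^sub>R 1) u = - ap P u" by (simp add: P_def)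
    ultimately show ?thesis using u uD by (intro exI[of _ u]) auto
  qed
  then show ?thesis using \<open>c \<le> M\<close> unfolding joint_def by blast
qed

text \<open>With the starting value \<open>- norm A\<close> the extremal hypothesis holds for every
  unit vector, so any commuting self-adjoint operator can be attached at some value.\<close>

lemma joint_insert:
  assumes "joint \<D>" "star A = A" "\<And>D. D \<in> \<D> \<Longrightarrow> D * A = A * D"
  shows "\<exists>M. joint (insert (A - M *\<^sub>R 1) \<D>)"
proof -
  have low: "- norm A \<le> Re (cinner u (ap A u))" if "norm u = 1" for u
    using Re_cinner_ap_le[of u A] that by simp
  have "\<exists>M\<ge>- norm A. joint (insert (A - M *\<^sub>R 1) \<D>)"
  proof (rule joint_extremal[OF assms(2,3)])
    fix e :: real assume "0 < e"
    then obtain u where "norm u = 1" "\<forall>D\<in>\<D>. norm (ap D u) < e"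
      using assms(1) unfolding joint_def by blast
    then show "\<exists>u. norm u = 1 \<and> (\<forall>D\<in>\<D>. norm (ap D u) < e) \<and> - norm A \<le> Re (cinner u (ap A u))"
      using low by blast
  qed
  then show ?thesis by blast
qed

section \<open>Approximate eigenvalues along a sequence\<close>

definition unit_seq :: "(nat \<Rightarrow> 'a::chilbert_space) \<Rightarrow> bool" where
  "unit_seq x \<longleftrightarrow> (\<forall>n. norm (x n) = 1)"

text \<open>Along a fixed unit sequence the assignment of \<open>c\<close> to \<open>T\<close> acts
  like a character: it respects sums, products and norm limits, and adjoints of normal operators.
  Functions of operators can thus be evaluated on numbers.\<close>

definition apx :: "'a::chilbert_space bop \<Rightarrow> complex \<Rightarrow> (nat \<Rightarrow> 'a) \<Rightarrow> bool" where
  "apx T c x \<longleftrightarrow> (\<lambda>n. ap (T - scal c) (x n)) \<longlonglongrightarrow> 0"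

lemma tendsto_ap_zero: "(\<lambda>n. y n) \<longlonglongrightarrow> 0 \<Longrightarrow> (\<lambda>n. ap T (y n)) \<longlonglongrightarrow> 0"
  using tendsto_ap[OF tendsto_const, of y 0 sequentially T] by simp

lemma apx_scal: "apx (scal c) c x"
  by (simp add: apx_def)

lemma apx_scaleR_one: "apx (r *\<^sub>R 1) (of_real r) x"
  by (simp add: apx_def cscale_of_real)

lemma apx_add: "apx S a x \<Longrightarrow> apx T b x \<Longrightarrow> apx (S + T) (a + b) x"
  unfolding apx_def by (drule (1) tendsto_add) (simp add: cscale_add_left algebra_simps)

lemma apx_diff: "apx S a x \<Longrightarrow> apx T b x \<Longrightarrow> apx (S - T) (a - b) x"
  unfolding apx_def by (drule (1) tendsto_diff) (simp add: cscale_diff_left algebra_simps)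

lemma apx_mult:
  assumes "apx S a x" "apx T b x"
  shows "apx (S * T) (a * b) x"
proof -
  have "(\<lambda>n. ap S (ap (T - scal b) (x n)) + ap (scal b) (ap (S - scal a) (x n))) \<longlonglongrightarrow> 0 + 0"
    by (intro tendsto_add tendsto_ap_zero[of "\<lambda>n. ap (T - scal b) (x n)"]
        tendsto_ap_zero[of "\<lambda>n. ap (S - scal a) (x n)"]) (use assms in \<open>simp_all only: apx_def\<close>)
  then show ?thesis
    by (simp add: apx_def cscale_cscale cscale_diff_right mult.commute)
qed

lemma apx_scaleR: "apx T c x \<Longrightarrow> apx (r *\<^sub>R T) (of_real r * c) x"
  using apx_mult[OF apx_scaleR_one, of T c x r] by simp

lemma apx_unique:
  assumes "unit_seq x" "apx T a x" "apx T b x"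
  shows "a = b"
proof -
  have "(\<lambda>n. norm (ap ((T - T) - scal (a - b)) (x n))) \<longlonglongrightarrow> 0"
    using apx_diff[OF assms(2,3)] unfolding apx_def by (rule tendsto_norm_zero)
  then have "(\<lambda>n. cmod (a - b)) \<longlonglongrightarrow> 0"
    using assms(1) by (simp add: unit_seq_def norm_cscale)
  then show ?thesis by (simp add: LIMSEQ_const_iff)
qed

lemma apx_lim:
  assumes x: "unit_seq x" and F: "F \<longlonglongrightarrow> T" and c: "c \<longlonglongrightarrow> a"
    and apx: "\<And>k. apx (F k) (c k) x"
  shows "apx T a x"
  unfolding apx_def
proof (rule LIMSEQ_I)
  fix e :: real assume "0 < e"
  then have "0 < e / 3" by simp
  from LIMSEQ_D[OF F this] obtain k1 where k1: "\<And>k. k \<ge> k1 \<Longrightarrow> norm (F k - T) < e / 3" by blast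
  from LIMSEQ_D[OF c \<open>0 < e / 3\<close>] obtain k2 where k2: "\<And>k. k \<ge> k2 \<Longrightarrow> norm (c k - a) < e / 3" by blast
  define k where "k = max k1 k2"
  from LIMSEQ_D[OF apx[of k, unfolded apx_def] \<open>0 < e / 3\<close>]
  obtain N where N: "\<And>n. n \<ge> N \<Longrightarrow> norm (ap (F k - scal (c k)) (x n)) < e / 3" by auto
  have "norm (ap (T - scal a) (x n) - 0) < e" if "n \<ge> N" for n
  proof -
    have nx: "norm (x n) = 1" using x by (simp add: unit_seq_def)
    have "ap (T - scal a) (x n) =
        ap (F k - scal (c k)) (x n) - ap (F k - T) (x n) + cscale (c k - a) (x n)"
      by (simp add: cscale_diff_left)
    also have "norm \<dots> \<le> norm (ap (F k - scal (c k)) (x n)) + norm (ap (F k - T) (x n))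
        + norm (cscale (c k - a) (x n))"
      by (meson add_right_mono norm_triangle_ineq norm_triangle_ineq4 order_trans)
    also have "\<dots> < e / 3 + e / 3 + e / 3"
      using N[OF that] k1[of k] k2[of k] norm_ap[of "F k - T" "x n"] nx
      by (intro add_strict_mono) (auto simp: norm_cscale k_def)
    finally show ?thesis by simp
  qed
  then show "\<exists>N. \<forall>n\<ge>N. norm (ap (T - scal a) (x n) - 0) < e" by blast
qed

definition normal :: "'a::chilbert_space bop \<Rightarrow> bool" where
  "normal N \<longleftrightarrow> star N * N = N * star N"

text \<open>A normal operator and its adjoint have equal norms on each vector; this is applied to
  the normal operator \<open>N - scal c\<close>.\<close>

lemma apx_star:
  assumes "normal N" "apx N c x"
  shows "apx (star N) (cnj c) x"
proof -
  let ?Z = "N - scal c"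
  have "star N * scal c = scal c * star N" "scal (cnj c) * N = N * scal (cnj c)"
    "scal (cnj c) * scal c = scal c * scal (cnj c)"
    by (rule scal_commute scal_commute[symmetric])+
  then have "star ?Z * ?Z = star (star ?Z) * star ?Z"
    using assms(1) by (simp add: normal_def left_diff_distrib right_diff_distrib)
  then have "(norm (ap ?Z v))\<^sup>2 = (norm (ap (star ?Z) v))\<^sup>2" for v
    unfolding norm_ap_square by simp
  then have "norm (ap ?Z v) = norm (ap (star ?Z) v)" for v
    by (simp add: power2_eq_iff_nonneg)
  then show ?thesis
    using assms(2) tendsto_norm_zero_iff[of "\<lambda>n. ap ?Z (x n)" sequentially]
      tendsto_norm_zero_iff[of "\<lambda>n. ap (star ?Z) (x n)" sequentially]
    by (simp add: apx_def)
qed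

definition re :: "'a::chilbert_space bop \<Rightarrow> 'a bop" where
  "re N = (1/2) *\<^sub>R (N + star N)"

definition im :: "'a::chilbert_space bop \<Rightarrow> 'a bop" where
  "im N = (1/2) *\<^sub>R (scal (- \<i>) * (N - star N))"

lemma star_re [simp]: "star (re N) = re N"
  by (simp add: re_def add.commute)

lemma star_im [simp]: "star (im N) = im N"
proof -
  have "(star N - N) * scal \<i> = scal (- \<i>) * (N - star N)"
    unfolding scal_commute[of _ "\<i>"] scal_simps by (simp add: right_diff_distrib)
  then show ?thesis by (simp add: im_def)
qed

lemma re_im: "N = re N + scal \<i> * im N"
proof (rule bop_eqI)
  fix x
  have "cscale \<i> ((1/2) *\<^sub>R cscale (- \<i>) (ap (N - star N) x)) = (1/2) *\<^sub>R ap (N - star N) x"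
    by (simp only: scaleR_cscale cscale_cscale) simp
  moreover have "(1/2) *\<^sub>R ap (N + star N) x + (1/2) *\<^sub>R ap (N - star N) x = ap N x"
    by (simp add: scaleR_right_diff_distrib scaleR_right_distrib flip: scaleR_left_distrib)
  ultimately show "ap N x = ap (re N + scal \<i> * im N) x"
    by (simp only: re_def im_def ap_simps ap_scal)
qed

lemma commute_re:
  assumes "W * N = N * W" "W * star N = star N * W"
  shows "W * re N = re N * W"
  using assms by (simp add: re_def algebra_simps)

lemma commute_im:
  assumes "W * N = N * W" "W * star N = star N * W"
  shows "W * im N = im N * W"
proof -
  have "W * (scal (- \<i>) * (N - star N)) = scal (- \<i>) * (W * (N - star N))"
    by (metis mult.assoc scal_commute)
  also have "W * (N - star N) = (N - star N) * W"
    using assms by (simp add: algebra_simps)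
  finally show ?thesis by (simp add: im_def mult.assoc)
qed

lemma apx_re:
  assumes "normal N" "apx N c x"
  shows "apx (re N) (of_real (Re c)) x"
  using apx_scaleR[OF apx_add[OF assms(2) apx_star[OF assms]], of "1/2"]
  by (simp add: re_def complex_add_cnj)

lemma apx_im:
  assumes "normal N" "apx N c x"
  shows "apx (im N) (of_real (Im c)) x"
proof -
  have "of_real (1/2) * (- \<i> * (c - cnj c)) = of_real (Im c)"
    by (simp add: complex_eq_iff)
  then show ?thesis
    using apx_scaleR[OF apx_mult[OF apx_scal apx_diff[OF assms(2) apx_star[OF assms]]], of "1/2" "- \<i>"]
    by (simp only: im_def)
qed

lemma joint_sequence:
  assumes "joint \<D>"
  obtains x where "unit_seq x" "\<And>D. D \<in> \<D> \<Longrightarrow> (\<lambda>n. ap D (x n)) \<longlonglongrightarrow> 0"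
proof -
  have "\<exists>u. norm u = 1 \<and> (\<forall>D\<in>\<D>. norm (ap D u) < 1 / real (Suc n))" for n
    using assms unfolding joint_def by simp
  then obtain x where x: "\<And>n. norm (x n) = 1" "\<And>n D. D \<in> \<D> \<Longrightarrow> norm (ap D (x n)) < 1 / real (Suc n)"
    by metis
  have "(\<lambda>n. ap D (x n)) \<longlonglongrightarrow> 0" if "D \<in> \<D>" for D
  proof (rule Lim_null_comparison)
    show "\<forall>\<^sub>F n in sequentially. norm (ap D (x n)) \<le> 1 / real (Suc n)"
      using x(2)[OF that] by (simp add: less_imp_le)
    show "(\<lambda>n. 1 / real (Suc n)) \<longlonglongrightarrow> 0"
      by (rule LIMSEQ_Suc[OF lim_1_over_n])
  qed
  then show thesis using x(1) that by (auto simp: unit_seq_def)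
qed

text \<open>Only self-adjoint operators can be attached, so \<open>X\<close> enters through its real
  and imaginary parts, one after the other.\<close>

lemma joint_normal:
  assumes "joint \<D>" "normal X"
    and comm: "\<And>D. D \<in> \<D> \<Longrightarrow> D * X = X * D" "\<And>D. D \<in> \<D> \<Longrightarrow> D * star X = star X * D"
  shows "\<exists>x l. unit_seq x \<and> (\<forall>D\<in>\<D>. (\<lambda>n. ap D (x n)) \<longlonglongrightarrow> 0) \<and> apx X l x"
proof -
  obtain a where a: "joint (insert (re X - a *\<^sub>R 1) \<D>)"
    using joint_insert[OF assms(1) star_re] commute_re comm by metis
  have "re X * X = X * re X" "re X * star X = star X * re X"
    using commute_re[of X X] commute_re[of "star X" X] assms(2) by (auto simp: normal_def)
  \<comment> \<open>Normality enters here: the second part must commute with the shifted first part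
    already in the set.\<close>
  then have "re X * im X = im X * re X" by (rule commute_im)
  then have "(re X - a *\<^sub>R 1) * im X = im X * (re X - a *\<^sub>R 1)"
    by (simp add: left_diff_distrib right_diff_distrib)
  then have "\<exists>b. joint (insert (im X - b *\<^sub>R 1) (insert (re X - a *\<^sub>R 1) \<D>))"
    using joint_insert[OF a star_im] commute_im comm by (metis insert_iff)
  then obtain b x where x: "unit_seq x"
    and D: "\<And>D. D \<in> insert (im X - b *\<^sub>R 1) (insert (re X - a *\<^sub>R 1) \<D>) \<Longrightarrow> (\<lambda>n. ap D (x n)) \<longlonglongrightarrow> 0"
    by (metis joint_sequence)
  have "apx (re X) (of_real a) x" "apx (im X) (of_real b) x"
    using D[of "re X - a *\<^sub>R 1"] D[of "im X - b *\<^sub>R 1"] by (auto simp: apx_def scal_simps)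
  then have "apx (re X + scal \<i> * im X) (of_real a + \<i> * of_real b) x"
    by (intro apx_add apx_mult apx_scal)
  then have "apx X (of_real a + \<i> * of_real b) x" by (simp flip: re_im)
  then show ?thesis using x D by blast
qed

text \<open>The substitute for the spectral theorem: an operator bound follows from a bound on
  numbers, tested on approximate eigenvectors common to \<open>T\<close> and
  \<open>X\<close>.\<close>

lemma norm_le_joint:
  assumes sa: "star T = T" and "normal X" and comm: "T * X = X * T"
    and "0 \<le> e"
    and le: "\<And>x t l. unit_seq x \<Longrightarrow> apx T (of_real t) x \<Longrightarrow> apx X l x \<Longrightarrow> \<bar>t\<bar> \<le> e"
  shows "norm T \<le> e"
proof (rule norm_bop_le[OF \<open>0 \<le> e\<close>])
  have comm': "T * star X = star X * T"
    using arg_cong[OF comm, of star] sa by simp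
  have unit: "norm (ap T u) \<le> e" if u: "norm u = 1" for u
  proof -
    have "(norm (ap T u))\<^sup>2 = Re (cinner u (ap (T * T) u))"
      unfolding norm_ap_square by (simp add: sa)
    \<comment> \<open>The square \<open>T * T\<close> is used because the form of \<open>T\<close>
      itself may reach the norm only at its negative end. Attaching \<open>T\<close> afterwards
      gives a value \<open>t\<close> with \<open>t\<^sup>2 = M\<close>.\<close>
    then have "\<exists>M\<ge>(norm (ap T u))\<^sup>2. joint (insert (T * T - M *\<^sub>R 1) {})"
      using u sa by (intro joint_extremal) (auto intro!: exI[of _ u])
    then obtain M where M: "(norm (ap T u))\<^sup>2 \<le> M" "joint {T * T - M *\<^sub>R 1}" by auto
    have "(T * T - M *\<^sub>R 1) * T = T * (T * T - M *\<^sub>R 1)"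
      by (simp add: left_diff_distrib right_diff_distrib mult.assoc)
    then obtain t where jt: "joint {T - t *\<^sub>R 1, T * T - M *\<^sub>R 1}"
      using joint_insert[OF M(2) sa] by auto
    have "T * T * X = X * (T * T)" "T * T * star X = star X * (T * T)"
      by (metis comm mult.assoc) (metis comm' mult.assoc)
    then have c1: "D * X = X * D" and c2: "D * star X = star X * D"
      if "D \<in> {T - t *\<^sub>R 1, T * T - M *\<^sub>R 1}" for D
      using that comm comm' by (auto simp: left_diff_distrib right_diff_distrib)
    obtain x l where x: "unit_seq x"
      and D: "\<And>D. D \<in> {T - t *\<^sub>R 1, T * T - M *\<^sub>R 1} \<Longrightarrow> (\<lambda>n. ap D (x n)) \<longlonglongrightarrow> 0"
      and l: "apx X l x"
      using joint_normal[OF jt \<open>normal X\<close> c1 c2] by blast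
    have t: "apx T (of_real t) x" and m: "apx (T * T) (of_real M) x"
      using D[of "T - t *\<^sub>R 1"] D[of "T * T - M *\<^sub>R 1"] by (auto simp: apx_def scal_simps)
    have "of_real M = (of_real t * of_real t :: complex)"
      by (rule apx_unique[OF x m apx_mult[OF t t]])
    then have "M = t\<^sup>2" by (simp add: power2_eq_square flip: of_real_mult)
    then have "(norm (ap T u))\<^sup>2 \<le> \<bar>t\<bar>\<^sup>2" using M(1) by simp
    then have "norm (ap T u) \<le> \<bar>t\<bar>" by (rule power2_le_imp_le) simp
    then show ?thesis using le[OF x t l] by simp
  qed
  fix x
  show "norm (ap T x) \<le> e * norm x"
  proof (cases "x = 0")
    case False
    then show ?thesis
      using unit[of "(1 / norm x) *\<^sub>R x"] by (simp add: divide_simps)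
  qed simp
qed

section \<open>Continuous functional calculus\<close>

text \<open>The relation \<open>F = f(N)\<close>, given by two traces of it: \<open>F\<close>
  commutes with whatever commutes with \<open>N\<close> and \<open>star N\<close>, and it acts as
  \<open>f c\<close> on approximate eigenvectors. On any set enclosing the approximate spectrum,
  \<open>f\<close> determines \<open>F\<close>; see \<open>fcalc_unique\<close>.\<close>

definition fcalc :: "'a::chilbert_space bop \<Rightarrow> (complex \<Rightarrow> real) \<Rightarrow> 'a bop \<Rightarrow> bool" where
  "fcalc N f F \<longleftrightarrow> star F = F \<and>
    (\<forall>W. W * N = N * W \<longrightarrow> W * star N = star N * W \<longrightarrow> W * F = F * W) \<and>
    (\<forall>x c. unit_seq x \<longrightarrow> apx N c x \<longrightarrow> apx F (of_real (f c)) x)"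

text \<open>Any enclosing set is allowed, so explicit compact sets can replace the spectrum.\<close>

definition approx_spectrum_in :: "'a::chilbert_space bop \<Rightarrow> complex set \<Rightarrow> bool" where
  "approx_spectrum_in N K \<longleftrightarrow> (\<forall>x c. unit_seq x \<longrightarrow> apx N c x \<longrightarrow> c \<in> K)"

lemma fcalc_self_adjoint: "fcalc N f F \<Longrightarrow> star F = F"
  by (simp add: fcalc_def)

lemma fcalc_commute: "fcalc N f F \<Longrightarrow> W * N = N * W \<Longrightarrow> W * star N = star N * W \<Longrightarrow> W * F = F * W"
  by (simp add: fcalc_def)

lemma fcalc_apx: "fcalc N f F \<Longrightarrow> unit_seq x \<Longrightarrow> apx N c x \<Longrightarrow> apx F (of_real (f c)) x"
  by (simp add: fcalc_def)

lemma fcalc_commute_base: "normal N \<Longrightarrow> fcalc N f F \<Longrightarrow> F * N = N * F \<and> F * star N = star N * F"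
  using fcalc_commute[of N f F N] fcalc_commute[of N f F "star N"] by (simp add: normal_def)

lemma fcalc_const: "fcalc N (\<lambda>_. r) (r *\<^sub>R 1)"
  by (simp add: fcalc_def apx_scaleR_one)

lemma fcalc_re: "normal N \<Longrightarrow> fcalc N Re (re N)"
  by (simp add: fcalc_def apx_re commute_re)

lemma fcalc_im: "normal N \<Longrightarrow> fcalc N Im (im N)"
  by (simp add: fcalc_def apx_im commute_im)

lemma fcalc_add: "fcalc N f F \<Longrightarrow> fcalc N g G \<Longrightarrow> fcalc N (\<lambda>c. f c + g c) (F + G)"
  by (auto simp: fcalc_def apx_add algebra_simps)

lemma fcalc_mult:
  assumes "normal N" "fcalc N f F" "fcalc N g G"
  shows "fcalc N (\<lambda>c. f c * g c) (F * G)"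
proof -
  have "F * G = G * F"
    using fcalc_commute[OF assms(3)] fcalc_commute_base[OF assms(1,2)] by blast
  have comm: "W * (F * G) = F * G * W" if "W * N = N * W" "W * star N = star N * W" for W
    using fcalc_commute[OF assms(2) that] fcalc_commute[OF assms(3) that] by (metis mult.assoc)
  show ?thesis
    unfolding fcalc_def
  proof (intro conjI allI impI)
    show "star (F * G) = F * G"
      using \<open>F * G = G * F\<close> assms by (simp add: fcalc_self_adjoint)
    show "apx (F * G) (of_real (f c * g c)) x" if "unit_seq x" "apx N c x" for x c
      using apx_mult[OF fcalc_apx[OF assms(2) that] fcalc_apx[OF assms(3) that]] by simp
  qed (rule comm)
qed

lemma fcalc_real_polynomial:
  assumes "normal N" "real_polynomial_function p"
  shows "\<exists>F. fcalc N p F"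
  using assms(2)
proof induction
  case (linear p)
  then interpret p: bounded_linear p .
  \<comment> \<open>The linear generators are arbitrary real functionals on the plane, hence
    combinations of \<open>Re\<close> and \<open>Im\<close>.\<close>
  have "p c = p 1 * Re c + p \<i> * Im c" for c
  proof -
    have "p c = p (Re c *\<^sub>R 1 + Im c *\<^sub>R \<i>)"
      by (intro arg_cong[of _ _ p]) (simp add: complex_eq_iff)
    then show ?thesis by (simp add: p.add p.scaleR mult.commute del: scaleR_complex.ctr)
  qed
  then have "p = (\<lambda>c. p 1 * Re c + p \<i> * Im c)" by blast
  moreover have "fcalc N (\<lambda>c. p 1 * Re c + p \<i> * Im c) (p 1 *\<^sub>R 1 * re N + p \<i> *\<^sub>R 1 * im N)"
    using assms(1) by (intro fcalc_add fcalc_mult fcalc_const fcalc_re fcalc_im)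
  ultimately show ?case by auto
qed (use assms(1) fcalc_const fcalc_add fcalc_mult in blast)+

text \<open>By \<open>norm_le_joint\<close> for \<open>F - G\<close> against \<open>N\<close>
  itself, the calculus is contractive for the supremum norm on \<open>K\<close>. This makes both
  uniqueness and the extension by uniform limits work.\<close>

lemma fcalc_norm_diff_le:
  assumes "normal N" "fcalc N f F" "fcalc N g G" "approx_spectrum_in N K" "0 \<le> e"
    and le: "\<And>c. c \<in> K \<Longrightarrow> \<bar>f c - g c\<bar> \<le> e"
  shows "norm (F - G) \<le> e"
proof (rule norm_le_joint[OF _ \<open>normal N\<close> _ \<open>0 \<le> e\<close>])
  show "star (F - G) = F - G"
    using assms by (simp add: fcalc_self_adjoint)
  show "(F - G) * N = N * (F - G)"
    using fcalc_commute_base[OF assms(1,2)] fcalc_commute_base[OF assms(1,3)]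
    by (simp add: left_diff_distrib right_diff_distrib)
  fix x t c assume *: "unit_seq x" "apx (F - G) (complex_of_real t) x" "apx N c x"
  have "complex_of_real t = of_real (f c) - of_real (g c)"
    using assms * by (intro apx_unique[OF *(1,2)] apx_diff) (auto intro: fcalc_apx)
  then have "t = f c - g c" by (simp flip: of_real_diff)
  moreover have "c \<in> K" using assms(4) * by (auto simp: approx_spectrum_in_def)
  ultimately show "\<bar>t\<bar> \<le> e" using le by simp
qed

lemma fcalc_unique:
  assumes "normal N" "fcalc N f F" "fcalc N g G" "approx_spectrum_in N K"
    and "\<And>c. c \<in> K \<Longrightarrow> f c = g c"
  shows "F = G"
  using fcalc_norm_diff_le[OF assms(1-4), of 0] assms(5) by simp

lemma fcalc_exists:
  assumes N: "normal N" and K: "approx_spectrum_in N K" and "compact K" "continuous_on K f"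
  shows "\<exists>F. fcalc N f F"
proof -
  have "\<exists>p. real_polynomial_function p \<and> (\<forall>c\<in>K. \<bar>f c - p c\<bar> < 1 / real (Suc n))" for n
  proof -
    obtain p where "real_polynomial_function p" "\<And>c. c \<in> K \<Longrightarrow> \<bar>f c - p c\<bar> < 1 / real (Suc n)"
      by (rule Stone_Weierstrass_real_polynomial_function[OF assms(3,4), of "1 / real (Suc n)"]) auto
    then show ?thesis by blast
  qed
  then obtain p where p: "\<And>n. real_polynomial_function (p n)"
    "\<And>n c. c \<in> K \<Longrightarrow> \<bar>f c - p n c\<bar> < 1 / real (Suc n)" by metis
  obtain F where F: "\<And>n. fcalc N (p n) (F n)"
    using fcalc_real_polynomial[OF N p(1)] by metis
  have FF: "norm (F i - F j) \<le> 1 / real (Suc i) + 1 / real (Suc j)" for i j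
  proof (rule fcalc_norm_diff_le[OF N F F K])
    fix c assume "c \<in> K"
    then show "\<bar>p i c - p j c\<bar> \<le> 1 / real (Suc i) + 1 / real (Suc j)"
      using p(2)[of c i] p(2)[of c j] by linarith
  qed simp
  have "Cauchy F"
  proof (rule metric_CauchyI)
    fix e :: real assume "0 < e"
    then have "0 < e / 2" by simp
    then obtain n where n: "1 / real (Suc n) < e / 2"
      by (rule nat_approx_posE)
    have le: "1 / real (Suc i) \<le> 1 / real (Suc n)" if "i \<ge> n" for i
      using that by (intro divide_left_mono) auto
    have "dist (F i) (F j) < e" if "i \<ge> n" "j \<ge> n" for i j
      using FF[of i j] le[OF that(1)] le[OF that(2)] n unfolding dist_norm by linarith
    then show "\<exists>M. \<forall>i\<ge>M. \<forall>j\<ge>M. dist (F i) (F j) < e" by blast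
  qed
  then obtain L where L: "F \<longlonglongrightarrow> L"
    using Cauchy_convergent convergent_def by blast
  have "star L = L"
  proof (rule LIMSEQ_unique)
    show "(\<lambda>n. star (F n)) \<longlonglongrightarrow> star L" by (rule bounded_linear.tendsto[OF bounded_linear_star L])
    show "(\<lambda>n. star (F n)) \<longlonglongrightarrow> L" using L by (simp add: fcalc_self_adjoint[OF F])
  qed
  moreover have "W * L = L * W" if "W * N = N * W" "W * star N = star N * W" for W
    by (rule commute_limit[OF L]) (rule fcalc_commute[OF F that])
  moreover have "apx L (of_real (f c)) x" if x: "unit_seq x" "apx N c x" for x c
  proof (rule apx_lim[OF x(1) L])
    show "apx (F k) (of_real (p k c)) x" for k by (rule fcalc_apx[OF F x])
    have "c \<in> K" using K x by (auto simp: approx_spectrum_in_def)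
    have "(\<lambda>k. p k c) \<longlonglongrightarrow> f c"
    proof (rule LIM_zero_cancel, rule Lim_null_comparison)
      show "\<forall>\<^sub>F k in sequentially. norm (p k c - f c) \<le> 1 / real (Suc k)"
        using p(2)[OF \<open>c \<in> K\<close>] by (simp add: abs_minus_commute less_imp_le)
      show "(\<lambda>k. 1 / real (Suc k)) \<longlonglongrightarrow> 0" by (rule LIMSEQ_Suc[OF lim_1_over_n])
    qed
    then show "(\<lambda>k. complex_of_real (p k c)) \<longlonglongrightarrow> of_real (f c)" by (rule tendsto_of_real)
  qed
  ultimately have "fcalc N f L" by (simp add: fcalc_def)
  then show ?thesis by blast
qed

lemma apx_norm_le:
  assumes "unit_seq x" "apx T c x"
  shows "cmod c \<le> norm T"
proof -
  have "(\<lambda>n. norm (ap (T - scal c) (x n))) \<longlonglongrightarrow> 0"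
    using assms(2) unfolding apx_def by (rule tendsto_norm_zero)
  moreover have "cmod c - norm T \<le> norm (ap (T - scal c) (x n))" for n
  proof -
    have "norm (x n) = 1" using assms(1) by (simp add: unit_seq_def)
    then show ?thesis
      using norm_triangle_ineq2[of "cscale c (x n)" "ap T (x n)"] norm_ap[of T "x n"]
      by (simp add: norm_cscale norm_minus_commute)
  qed
  ultimately have "cmod c - norm T \<le> 0"
    by (intro LIMSEQ_le_const) auto
  then show ?thesis by simp
qed

section \<open>Positive square roots\<close>

lemma positive_self_adjoint: "positive_op (ap T) \<Longrightarrow> star T = T"
  by (rule self_adjointI) (simp add: positive_op_def)

lemma positive_star_mult: "positive_op (ap (star T * T))"
proof -
  have "cinner x (ap (star T * T) x) = complex_of_real ((norm (ap T x))\<^sup>2)" for x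
    by (simp only: ap_simps cinner_star cinner_self)
  then show ?thesis
    unfolding positive_op_def by (simp only: bounded_op_ap Im_complex_of_real Re_complex_of_real) simp
qed

lemma positive_apx:
  assumes "positive_op (ap T)" "unit_seq x" "apx T c x"
  shows "0 \<le> Re c" "Im c = 0"
proof -
  have "normal T" using positive_self_adjoint[OF assms(1)] by (simp add: normal_def)
  then have "apx T (cnj c) x"
    using apx_star assms(3) positive_self_adjoint[OF assms(1)] by metis
  then have "cnj c = c" using apx_unique assms(2,3) by blast
  then show "Im c = 0" by (simp add: complex_eq_iff)
  have "(\<lambda>n. norm (ap (T - scal c) (x n))) \<longlonglongrightarrow> 0"
    using assms(3) unfolding apx_def by (rule tendsto_norm_zero)
  moreover have "- Re c \<le> norm (ap (T - scal c) (x n))" for n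
  proof -
    have nx: "norm (x n) = 1" using assms(2) by (simp add: unit_seq_def)
    have "Re (cinner (x n) (ap (T - scal c) (x n))) = Re (cinner (x n) (ap T (x n))) - Re c"
      by (simp add: cinner_simps cinner_self nx)
    moreover have "0 \<le> Re (cinner (x n) (ap T (x n)))"
      using assms(1) by (simp add: positive_op_def)
    moreover have "Re (cinner (x n) (ap (T - scal c) (x n))) \<le> norm (ap (T - scal c) (x n))"
      using complex_Re_le_cmod norm_cinner_le[of "x n"] nx by (metis mult_1 order_trans)
    ultimately show ?thesis by linarith
  qed
  ultimately have "- Re c \<le> 0" by (intro LIMSEQ_le_const) auto
  then show "0 \<le> Re c" by simp
qed

lemma positive_root_exists:
  assumes "positive_op (ap T)"
  shows "\<exists>R. positive_op (ap R) \<and> R * R = T \<and> (\<forall>W. W * T = T * W \<longrightarrow> W * R = R * W)"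
proof -
  have sa: "star T = T" by (rule positive_self_adjoint[OF assms])
  then have N: "normal T" by (simp add: normal_def)
  define K where "K = {c. 0 \<le> Re c} \<inter> cball 0 (norm T)"
  have K: "approx_spectrum_in T K"
    using positive_apx[OF assms] apx_norm_le by (auto simp: approx_spectrum_in_def K_def)
  have "compact K"
    unfolding K_def by (intro closed_Int_compact compact_cball closed_halfspace_Re_ge)
  \<comment> \<open>The fourth root is taken so that the square root
    \<open>Q * Q = star Q * Q\<close> is visibly positive.\<close>
  moreover have "continuous_on K (\<lambda>c. sqrt (sqrt (Re c)))"
    by (intro continuous_intros)
  ultimately obtain Q where Q: "fcalc T (\<lambda>c. sqrt (sqrt (Re c))) Q"
    using fcalc_exists[OF N K] by blast
  have saQ: "star Q = Q" by (rule fcalc_self_adjoint[OF Q])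
  have "re T = T" by (simp add: re_def sa flip: scaleR_add_left)
  then have T: "fcalc T Re T" using fcalc_re[OF N] by simp
  note QQ = fcalc_mult[OF N Q Q]
  have "Q * Q * (Q * Q) = T"
    by (rule fcalc_unique[OF N fcalc_mult[OF N QQ QQ] T K]) (simp add: K_def)
  moreover have "positive_op (ap (Q * Q))"
    using positive_star_mult[of Q] by (simp only: saQ)
  moreover have "W * (Q * Q) = Q * Q * W" if "W * T = T * W" for W
  proof -
    have "W * Q = Q * W" using fcalc_commute[OF Q that] that sa by simp
    then show ?thesis by (metis mult.assoc)
  qed
  ultimately show ?thesis by blast
qed

text \<open>With \<open>Q\<close> the positive root of \<open>R\<close>, the form of
  \<open>R\<close> at \<open>y\<close> is the squared norm of \<open>ap Q y\<close>.\<close>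

lemma positive_cinner_zero:
  assumes "positive_op (ap R)" "Re (cinner y (ap R y)) = 0"
  shows "ap R y = 0"
proof -
  obtain Q where Q: "positive_op (ap Q)" "Q * Q = R"
    using positive_root_exists[OF assms(1)] by blast
  have "(norm (ap Q y))\<^sup>2 = 0"
    unfolding norm_ap_square positive_self_adjoint[OF Q(1)] Q(2) by (rule assms(2))
  then have "ap (Q * Q) y = 0" by simp
  then show ?thesis by (simp only: Q(2))
qed

text \<open>On the range of \<open>R - R'\<close> the sum \<open>R + R'\<close> vanishes, so both
  positive forms vanish there, and \<open>R\<close> and \<open>R'\<close> with them. Hence the
  self-adjoint \<open>R - R'\<close> has square zero.\<close>

lemma positive_root_unique_aux:
  assumes R: "positive_op (ap R)" and R': "positive_op (ap R')"
    and eq: "R * R = R' * R'" and comm: "R * R' = R' * R"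
  shows "R = R'"
proof (rule bop_eqI)
  fix x
  have sa: "star (R - R') = R - R'"
    using R R' by (simp add: positive_self_adjoint)
  have prod: "(R + R') * (R - R') = 0"
    by (simp only: distrib_right right_diff_distrib eq comm) simp
  define y where "y = ap (R - R') x"
  have "ap ((R + R') * (R - R')) x = 0" by (simp only: prod ap_simps)
  then have sum: "ap R y + ap R' y = 0" by (simp only: y_def ap_simps)
  then have "cinner y (ap R y) + cinner y (ap R' y) = 0"
    by (simp only: cinner_add_right[symmetric] cinner_zero_right)
  then have "Re (cinner y (ap R y)) + Re (cinner y (ap R' y)) = 0"
    by (simp only: plus_complex.sel[symmetric] zero_complex.sel)
  moreover have "0 \<le> Re (cinner y (ap R y))" "0 \<le> Re (cinner y (ap R' y))"
    using R R' by (auto simp: positive_op_def)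
  ultimately have "Re (cinner y (ap R y)) = 0" by linarith
  then have "ap R y = 0" by (rule positive_cinner_zero[OF R])
  with sum have "ap (R - R') y = 0" by simp
  moreover have "(norm y)\<^sup>2 = Re (cinner x (ap (R - R') y))"
    unfolding y_def norm_ap_square sa by (simp only: ap_simps)
  ultimately have "(norm y)\<^sup>2 = 0" by (simp only: cinner_zero_right zero_complex.sel)
  then have "y = 0" by simp
  then show "ap R x = ap R' x" by (simp add: y_def)
qed

text \<open>The root built in \<open>positive_root_exists\<close> commutes with everything commuting
  with \<open>R * R\<close>, in particular with \<open>R\<close>, so it coincides with
  \<open>R\<close>.\<close>

lemma positive_root_commute:
  assumes "positive_op (ap R)" "W * (R * R) = R * R * W"
  shows "W * R = R * W"
proof -
  have "positive_op (ap (R * R))"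
    using positive_star_mult[of R] by (simp only: positive_self_adjoint[OF assms(1)])
  from positive_root_exists[OF this]
  obtain R' where R': "positive_op (ap R')" "R' * R' = R * R"
    and comm: "\<And>W. W * (R * R) = R * R * W \<Longrightarrow> W * R' = R' * W"
    by blast
  have "R * R' = R' * R" by (rule comm) (simp only: mult.assoc)
  then have "R = R'" by (rule positive_root_unique_aux[OF assms(1) R'(1) R'(2)[symmetric]])
  then show ?thesis using comm[OF assms(2)] by simp
qed

lemma positive_root_unique:
  assumes "positive_op (ap R)" "positive_op (ap R')" "R * R = R' * R'"
  shows "R = R'"
proof -
  have "R' * (R * R) = R * R * R'" unfolding assms(3) by (rule mult.assoc[symmetric])
  then have "R' * R = R * R'" by (rule positive_root_commute[OF assms(1)])
  then show ?thesis by (intro positive_root_unique_aux[OF assms]) simp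
qed

section \<open>Fuglede's theorem for invertible normal operators\<close>

text \<open>Taking roots of order \<open>2 ^ k\<close> removes the constant
  \<open>K\<close>.\<close>

lemma le_from_power_bound:
  fixes p q K :: real
  assumes "0 \<le> p" "0 \<le> q" and le: "\<And>k::nat. p ^ 2 ^ k \<le> K * q ^ 2 ^ k"
  shows "p \<le> q"
proof (rule ccontr)
  assume "\<not> p \<le> q"
  then have "q < p" by simp
  show False
  proof (cases "q = 0")
    case True
    then show False using le[of 0] \<open>q < p\<close> by simp
  next
    case False
    then have "0 < q" using assms by simp
    then have r: "1 < p / q" using \<open>q < p\<close> by simp
    obtain n where n: "K < (p / q) ^ n" using real_arch_pow[OF r] by blast
    also have "(p / q) ^ n \<le> (p / q) ^ 2 ^ n"
      using r by (intro power_increasing) (auto simp: less_imp_le)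
    also have "\<dots> \<le> K"
      using le[of n] \<open>0 < q\<close> by (simp add: power_divide divide_simps)
    finally show False by simp
  qed
qed

lemma norm_bop_power_le: "norm (T ^ n :: 'a::chilbert_space bop) \<le> norm T ^ n"
proof (induction n)
  case (Suc n)
  have "norm (T ^ Suc n) \<le> norm T * norm (T ^ n)" by (simp add: norm_mult_ineq)
  also have "\<dots> \<le> norm T * norm T ^ n" by (intro mult_left_mono Suc) simp
  finally show ?case by simp
qed (simp add: norm_one_bop_le)

lemma power_inverse_mult:
  fixes S T :: "'a::monoid_mult"
  assumes "T * S = 1"
  shows "T ^ n * S ^ n = 1"
proof (induction n)
  case (Suc n)
  have "T ^ Suc n * S ^ Suc n = T ^ n * (T * S) * S ^ n"
    by (simp only: power_Suc2[of T] power_Suc[of S] mult.assoc)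
  then show ?case using Suc assms by simp
qed simp

text \<open>One conjugation step by \<open>T\<close> and \<open>S\<close> looks like one by
  \<open>U\<close> and \<open>V\<close>; the commutation hypotheses let each new step pass to
  \<open>Y\<close>.\<close>

lemma orbit_power:
  fixes S T U V Y :: "'a::monoid_mult"
  assumes "T * Y * S = U * Y * V" "T * U = U * T" "V * S = S * V"
  shows "T ^ n * Y * S ^ n = U ^ n * Y * V ^ n"
proof (induction n)
  case (Suc n)
  have "T ^ Suc n * Y * S ^ Suc n = T * (T ^ n * Y * S ^ n) * S"
    by (simp only: power_Suc[of T] power_Suc2[of S] mult.assoc)
  also have "\<dots> = T * (U ^ n * Y * V ^ n) * S" by (simp only: Suc)
  also have "\<dots> = (T * U ^ n) * Y * (V ^ n * S)" by (simp only: mult.assoc)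
  also have "T * U ^ n = U ^ n * T"
    using power_commuting_commutes[of U T n] assms(2) by simp
  also have "V ^ n * S = S * V ^ n"
    using power_commuting_commutes[of V S n] assms(3) by simp
  also have "U ^ n * T * Y * (S * V ^ n) = U ^ n * (T * Y * S) * V ^ n"
    by (simp only: mult.assoc)
  also have "\<dots> = U ^ Suc n * Y * V ^ Suc n"
    unfolding assms(1) by (simp only: power_Suc2[of U] power_Suc[of V] mult.assoc)
  finally show ?case .
qed simp

text \<open>With \<open>a n = norm (T ^ n * Y * S ^ n)\<close> one has \<open>(a n)\<^sup>2 \<le> a 0 * a (2 * n)\<close>, because the norm of the
  self-adjoint operator \<open>star (T ^ n * Y * S ^ n) * (T ^ n * Y * S ^ n)\<close> is its spectral radius, which
  does not change under conjugation by \<open>T ^ n\<close>. A bounded sequence with this property is dominated by \<open>a 0\<close>.\<close>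

lemma orbit_contraction:
  fixes S T Y :: "'a::chilbert_space bop"
  assumes sa: "star T = T" "star S = S" and inv: "T * S = 1" "S * T = 1"
    and bound: "\<And>n. norm (T ^ n * Y * S ^ n) \<le> C"
  shows "norm (T * Y * S) \<le> norm Y"
proof -
  define a where "a n = norm (T ^ n * Y * S ^ n)" for n
  have inv_n: "T ^ n * S ^ n = 1" "S ^ n * T ^ n = 1" for n
    using power_inverse_mult inv by blast+
  have step: "(a n)\<^sup>2 \<le> a 0 * a (2 * n)" for n
  proof -
    define Z where "Z = T ^ n * Y * S ^ n"
    define P where "P = star Z * Z"
    \<comment> \<open>\<open>Q\<close> is \<open>P\<close> conjugated by \<open>T ^ n\<close>: all
      factors \<open>T ^ n\<close> and \<open>S ^ n\<close> of the left half move to the right,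
      leaving \<open>star Y\<close> bare.\<close>
    define Q where "Q = star Y * (T ^ (2 * n) * Y * S ^ (2 * n))"
    have "S ^ n * Q * T ^ n = S ^ n * star Y * T ^ n * T ^ n * Y * S ^ n * (S ^ n * T ^ n)"
      by (simp only: Q_def mult_2 power_add mult.assoc)
    also have "\<dots> = P"
      by (simp only: P_def Z_def star_simps star_power sa inv_n mult.assoc mult_1_right)
    finally have P: "P = S ^ n * Q * T ^ n" by simp
    have P_pow: "P ^ m = S ^ n * Q ^ m * T ^ n" for m
    proof (induction m)
      case (Suc m)
      have "P ^ Suc m = S ^ n * Q * (T ^ n * S ^ n) * Q ^ m * T ^ n"
        by (simp only: power_Suc Suc) (simp only: P mult.assoc)
      then show ?case by (simp only: inv_n power_Suc mult.assoc mult_1_left)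
    qed (simp add: inv_n)
    \<comment> \<open>Similarity costs the constant \<open>norm (S ^ n) * norm (T ^ n)\<close> for
      every power, and this constant disappears in the roots of order \<open>2 ^ k\<close>.\<close>
    have "norm P \<le> norm Q"
    proof (rule le_from_power_bound)
      fix k :: nat
      have "norm P ^ 2 ^ k = norm (P ^ 2 ^ k)"
        by (rule norm_self_adjoint_power[symmetric]) (simp add: P_def)
      also have "\<dots> \<le> norm (S ^ n) * norm (Q ^ 2 ^ k) * norm (T ^ n)"
        unfolding P_pow by (meson mult_right_mono norm_ge_zero norm_mult_ineq order_trans)
      also have "\<dots> \<le> norm (S ^ n) * norm Q ^ 2 ^ k * norm (T ^ n)"
        by (intro mult_right_mono mult_left_mono norm_bop_power_le) auto
      finally show "norm P ^ 2 ^ k \<le> norm (S ^ n) * norm (T ^ n) * norm Q ^ 2 ^ k"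
        by (simp add: ac_simps)
    qed auto
    also have "norm Q \<le> norm (star Y) * a (2 * n)"
      unfolding Q_def a_def by (rule norm_mult_ineq)
    finally show ?thesis
      using norm_star_mult[of Z] by (simp add: P_def a_def Z_def)
  qed
  have a0: "0 \<le> a n" for n by (simp add: a_def)
  show ?thesis
  proof (cases "Y = 0")
    case False
    have "a 1 \<le> a 0"
    proof (rule le_from_power_bound)
      fix k :: nat
      have pos: "0 < a 0" using False by (simp add: a_def)
      \<comment> \<open>The convexity estimate \<open>step\<close> iterated along
        \<open>n = 2 ^ k\<close>; the uniform bound \<open>C\<close> then controls the last
        factor.\<close>
      have "a 0 * a 1 ^ 2 ^ k \<le> a 0 ^ 2 ^ k * a (2 ^ k)"
      proof (induction k)
        case (Suc k)
        have "a 0 * (a 0 * a 1 ^ 2 ^ Suc k) = (a 0 * a 1 ^ 2 ^ k)\<^sup>2"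
          by (simp add: power_mult_distrib power2_eq_square power_add[symmetric] mult_2 ac_simps)
        also have "\<dots> \<le> (a 0 ^ 2 ^ k * a (2 ^ k))\<^sup>2"
          using Suc a0 by (intro power_mono) auto
        also have "\<dots> = a 0 ^ 2 ^ Suc k * (a (2 ^ k))\<^sup>2"
          by (simp add: power_mult_distrib power_mult[symmetric] mult.commute)
        also have "\<dots> \<le> a 0 ^ 2 ^ Suc k * (a 0 * a (2 * 2 ^ k))"
          using a0 by (intro mult_left_mono step) auto
        finally show ?case using pos by (simp add: mult.left_commute)
      qed (simp add: mult.commute)
      also have "\<dots> \<le> a 0 ^ 2 ^ k * C"
        using bound a0 by (intro mult_left_mono) (auto simp: a_def)
      finally show "a 1 ^ 2 ^ k \<le> C / a 0 * a 0 ^ 2 ^ k"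
        using pos by (simp add: field_simps)
    qed (rule a0)+
    then show ?thesis by (simp add: a_def)
  qed simp
qed

text \<open>Contraction is applied to \<open>1 + \<i> t Y\<close>, whose norm exceeds 1 only to
  second order in \<open>t\<close> as \<open>Y\<close> is self-adjoint. Hence the first-order term
  for the image, \<open>Im (cinner x (ap W x))\<close>, must vanish.\<close>

lemma orbit_self_adjoint:
  fixes S T Y :: "'a::chilbert_space bop"
  assumes sa: "star T = T" "star S = S" and inv: "T * S = 1" "S * T = 1" and "star Y = Y"
    and bound: "\<And>n. norm (T ^ n * Y * S ^ n) \<le> C"
  shows "star (T * Y * S) = T * Y * S"
proof (rule self_adjointI)
  fix x
  define W where "W = T * Y * S"
  have "0 \<le> (2 * Im (cinner x (ap W x))) * t + ((norm Y * norm x)\<^sup>2 - (norm (ap W x))\<^sup>2) * t\<^sup>2" for t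
  proof -
    define c where "c = \<i> * complex_of_real t"
    define Z where "Z = 1 + scal c * Y"
    have conj: "T ^ n * Z * S ^ n = 1 + scal c * (T ^ n * Y * S ^ n)" for n
    proof -
      have "T ^ n * (scal c * Y) * S ^ n = scal c * (T ^ n * Y * S ^ n)"
        by (metis mult.assoc scal_commute)
      then show ?thesis
        by (simp add: Z_def distrib_left distrib_right power_inverse_mult inv)
    qed
    have "norm (T * Z * S) \<le> norm Z"
    proof (rule orbit_contraction[OF sa inv])
      fix n
      have "norm (T ^ n * Z * S ^ n) \<le> norm (1 :: 'a bop) + norm (scal c * (T ^ n * Y * S ^ n))"
        unfolding conj by (rule norm_triangle_ineq)
      also have "\<dots> \<le> 1 + norm (scal c :: 'a bop) * norm (T ^ n * Y * S ^ n)"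
        by (intro add_mono norm_one_bop_le norm_mult_ineq)
      also have "\<dots> \<le> 1 + cmod c * C"
        by (intro add_left_mono mult_mono norm_scal_le bound) auto
      finally show "norm (T ^ n * Z * S ^ n) \<le> 1 + cmod c * C" .
    qed
    moreover have "T * Z * S = 1 + scal c * W"
      using conj[of 1] by (simp add: W_def)
    moreover have "norm (ap (T * Z * S) x) \<le> norm (T * Z * S) * norm x" by (rule norm_ap)
    ultimately have "norm (x + cscale c (ap W x)) \<le> norm Z * norm x"
      by simp (meson mult_right_mono norm_ge_zero order_trans)
    then have "(norm (x + cscale c (ap W x)))\<^sup>2 \<le> (norm Z)\<^sup>2 * (norm x)\<^sup>2"
      using power_mono[of _ _ 2] by (fastforce simp: power_mult_distrib)
    also have "(norm (x + cscale c (ap W x)))\<^sup>2 =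
        (norm x)\<^sup>2 - 2 * t * Im (cinner x (ap W x)) + t\<^sup>2 * (norm (ap W x))\<^sup>2"
      by (simp add: norm_add_square cinner_simps norm_cscale c_def norm_mult power_mult_distrib)
    also have "(norm Z)\<^sup>2 * (norm x)\<^sup>2 \<le> (1 + t\<^sup>2 * (norm Y)\<^sup>2) * (norm x)\<^sup>2"
    proof (rule mult_right_mono)
      have "star Z * Z = 1 + (t\<^sup>2) *\<^sub>R (Y * Y)"
      proof (rule bop_eqI)
        fix v
        have "- c * c = of_real (t\<^sup>2)"
          by (simp add: c_def power2_eq_square complex_eq_iff)
        then have "cscale (- c) (cscale c w) = t\<^sup>2 *\<^sub>R w" for w :: 'a
          by (simp only: cscale_cscale scaleR_cscale)
        then show "ap (star Z * Z) v = ap (1 + t\<^sup>2 *\<^sub>R (Y * Y)) v"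
          by (simp add: Z_def \<open>star Y = Y\<close> c_def cscale_add_right cscale_diff_right cscale_minus_left)
      qed
      then have "norm (star Z * Z) \<le> norm (1 :: 'a bop) + norm (t\<^sup>2 *\<^sub>R (Y * Y))"
        using norm_triangle_ineq by metis
      also have "\<dots> \<le> 1 + t\<^sup>2 * (norm Y * norm Y)"
        by (simp add: norm_one_bop_le add_mono mult_left_mono norm_mult_ineq)
      finally show "(norm Z)\<^sup>2 \<le> 1 + t\<^sup>2 * (norm Y)\<^sup>2"
        by (simp add: norm_star_mult power2_eq_square)
    qed simp
    finally show ?thesis by (simp add: algebra_simps power_mult_distrib)
  qed
  from linear_quadratic_zero[OF this] show "Im (cinner x (ap (T * Y * S) x)) = 0"
    by (simp add: W_def)
qed

text \<open>Self-adjointness of \<open>T * Y * S\<close> means \<open>S * Y * T = T * Y * S\<close>;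
  multiplying by \<open>T\<close> on both sides gives the claim.\<close>

lemma orbit_commute_self_adjoint:
  fixes S T Y :: "'a::chilbert_space bop"
  assumes sa: "star T = T" "star S = S" and inv: "T * S = 1" "S * T = 1" and "star Y = Y"
    and bound: "\<And>n. norm (T ^ n * Y * S ^ n) \<le> C"
  shows "Y * (T * T) = T * T * Y"
proof -
  have "S * (Y * T) = T * (Y * S)"
    using orbit_self_adjoint[OF assms] sa \<open>star Y = Y\<close> by (simp add: mult.assoc)
  then have "T * (S * (Y * T)) * T = T * (T * (Y * S)) * T" by simp
  moreover have "T * (S * (Y * T)) * T = (T * S) * Y * (T * T)" by (simp only: mult.assoc)
  moreover have "T * (T * (Y * S)) * T = T * T * Y * (S * T)" by (simp only: mult.assoc)
  ultimately show ?thesis by (simp add: inv)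
qed

text \<open>Splitting \<open>Y\<close> into real and imaginary parts brings in the orbit of
  \<open>star Y\<close>, the adjoint of the orbit of \<open>Y\<close> with \<open>T\<close> and
  \<open>S\<close> exchanged; hence two bounds. Positivity of \<open>T\<close> allows the passage
  from \<open>T * T\<close> to \<open>T\<close>.\<close>

lemma orbit_commute:
  fixes S T Y :: "'a::chilbert_space bop"
  assumes pos: "positive_op (ap T)" and sa: "star S = S" and inv: "T * S = 1" "S * T = 1"
    and bound: "\<And>n. norm (T ^ n * Y * S ^ n) \<le> C" "\<And>n. norm (S ^ n * Y * T ^ n) \<le> C"
  shows "Y * T = T * Y"
proof -
  have saT: "star T = T" by (rule positive_self_adjoint[OF pos])
  have st: "T ^ n * star Y * S ^ n = star (S ^ n * Y * T ^ n)" for n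
    by (simp add: star_power saT sa mult.assoc)
  have "norm (T ^ n * re Y * S ^ n) \<le> C" for n
  proof -
    have "T ^ n * re Y * S ^ n = (1/2) *\<^sub>R (T ^ n * Y * S ^ n + T ^ n * star Y * S ^ n)"
      by (simp add: re_def distrib_left distrib_right)
    moreover have "norm (T ^ n * Y * S ^ n + T ^ n * star Y * S ^ n)
        \<le> norm (T ^ n * Y * S ^ n) + norm (S ^ n * Y * T ^ n)"
      unfolding st using norm_triangle_ineq norm_star by metis
    ultimately have "norm (T ^ n * re Y * S ^ n) \<le> (1/2) * (norm (T ^ n * Y * S ^ n) + norm (S ^ n * Y * T ^ n))"
      by simp
    then show ?thesis using bound[of n] by simp
  qed
  then have re: "re Y * (T * T) = T * T * re Y"
    by (rule orbit_commute_self_adjoint[OF saT sa inv star_re])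
  have "norm (T ^ n * im Y * S ^ n) \<le> C" for n
  proof -
    define D where "D = T ^ n * Y * S ^ n - T ^ n * star Y * S ^ n"
    have "T ^ n * (scal (- \<i>) * (Y - star Y)) * S ^ n = scal (- \<i>) * (T ^ n * (Y - star Y) * S ^ n)"
      by (metis mult.assoc scal_commute)
    then have "T ^ n * im Y * S ^ n = (1/2) *\<^sub>R (scal (- \<i>) * D)"
      by (simp add: im_def D_def left_diff_distrib right_diff_distrib)
    moreover have "norm (scal (- \<i>) * D) \<le> 1 * norm D"
      using norm_mult_ineq[of "scal (- \<i>)" D] norm_scal_le[of "- \<i>"]
      by (metis mult_right_mono norm_ge_zero norm_ii norm_minus_cancel order_trans)
    moreover have "norm D \<le> norm (T ^ n * Y * S ^ n) + norm (S ^ n * Y * T ^ n)"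
      unfolding D_def st using norm_triangle_ineq4 norm_star by metis
    ultimately show ?thesis using bound[of n] by simp
  qed
  then have im: "im Y * (T * T) = T * T * im Y"
    by (rule orbit_commute_self_adjoint[OF saT sa inv star_im])
  have "(scal \<i> * im Y) * (T * T) = scal \<i> * (T * T * im Y)"
    by (simp only: mult.assoc im)
  also have "\<dots> = T * T * (scal \<i> * im Y)" by (metis mult.assoc scal_commute)
  finally have "(re Y + scal \<i> * im Y) * (T * T) = T * T * (re Y + scal \<i> * im Y)"
    by (simp only: distrib_left distrib_right re)
  then have "Y * (T * T) = T * T * Y" by (simp only: re_im[symmetric])
  then show ?thesis by (rule positive_root_commute[OF pos])
qed

text \<open>\<open>U\<close> is unitary with adjoint \<open>V\<close>, so orbits of \<open>Y\<close>
  under \<open>T\<close> are as bounded as orbits under a unitary. Once \<open>Y\<close> commutes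
  with \<open>star N * N\<close>, the invertible factor \<open>N\<close> cancels.\<close>

lemma fuglede_invertible:
  fixes M N Y :: "'a::chilbert_space bop"
  assumes "normal N" and inv: "M * N = 1" "N * M = 1" and comm: "Y * N = N * Y"
  shows "Y * star N = star N * Y"
proof -
  define N' M' where "N' = star N" and "M' = star M"
  have nn: "N * N' = N' * N" using assms(1) by (simp add: normal_def N'_def)
  have inv': "N' * M' = 1" "M' * N' = 1"
    using arg_cong[OF inv(1), of star] arg_cong[OF inv(2), of star] by (simp_all add: N'_def M'_def)
  have mn: "M * N' = N' * M"
    by (metis inv mult.assoc mult_1_left mult_1_right nn)
  have nm: "N * M' = M' * N"
    using arg_cong[OF mn, of star] by (simp add: N'_def M'_def)
  have mm: "M * M' = M' * M"
    by (metis inv' mn mult.assoc mult_1_left mult_1_right)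
  have ym: "Y * M = M * Y"
    by (metis comm inv mult.assoc mult_1_left mult_1_right)
  define T S U V where "T = N' * N" and "S = M * M'" and "U = N' * M" and "V = N * M'"
  have starU: "star U = V" by (simp add: U_def V_def N'_def M'_def nm[unfolded M'_def])
  have saS: "star S = S" by (simp add: S_def M'_def)
  have posT: "positive_op (ap T)" unfolding T_def N'_def by (rule positive_star_mult)
  have TS: "T * S = 1"
    by (metis S_def T_def inv' inv mult.assoc mult_1_left)
  have ST: "S * T = 1"
    by (metis S_def T_def inv' inv mult.assoc mult_1_left)
  have TU: "T * U = U * T"
    by (metis T_def U_def inv mn mult.assoc mult_1_left mult_1_right nn)
  have US: "U * S = S * U"
    by (metis TU TS ST mult.assoc mult_1_left mult_1_right)
  have VS: "V * S = S * V"
    using arg_cong[OF US, of star] by (simp add: starU saS)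
  have VT: "T * V = V * T"
    using arg_cong[OF TU, of star] positive_self_adjoint[OF posT] by (simp add: starU)
  have TYS: "T * Y * S = U * Y * V"
  proof -
    have "T * Y * S = N' * (N * Y * M) * M'" by (simp only: T_def S_def mult.assoc)
    \<comment> \<open>Both sides equal \<open>Y\<close>; exchanging them trades the positive
      conjugation for the unitary one.\<close>
    also have "N * Y * M = M * Y * N"
      by (metis comm ym inv mult.assoc mult_1_left mult_1_right)
    finally show ?thesis by (simp only: U_def V_def mult.assoc)
  qed
  have SYT: "S * Y * T = V * Y * U"
  proof -
    have "S * Y * T = M' * (M * Y * N) * N'"
      by (simp only: T_def S_def mm nn[symmetric] mult.assoc)
    also have "M * Y * N = N * Y * M"
      by (metis comm ym inv mult.assoc mult_1_left mult_1_right)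
    also have "M' * (N * Y * M) * N' = (M' * N) * Y * (M * N')" by (simp only: mult.assoc)
    finally show ?thesis by (simp only: U_def V_def mn nm)
  qed
  have "V * U = 1"
    by (metis U_def V_def inv inv' mult.assoc mult_1_left mult_1_right nm nn)
  then have "(norm U)\<^sup>2 \<le> 1"
    using norm_star_mult[of U] norm_one_bop_le[where 'a = 'a] by (simp add: starU)
  then have "norm U \<le> 1" by (simp add: abs_square_le_1)
  then have "norm U ^ n \<le> 1" for n by (simp add: power_le_one)
  then have U_pow: "norm (U ^ n) \<le> 1" for n
    using norm_bop_power_le order_trans by blast
  have V_pow: "norm (V ^ n) \<le> 1" for n
    using U_pow[of n] norm_star[of "U ^ n"] by (simp only: star_power starU)
  have bound: "norm (A * Y * B) \<le> norm Y" if "norm A \<le> 1" "norm B \<le> 1" for A B :: "'a bop"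
  proof -
    have "norm (A * Y * B) \<le> norm A * norm Y * norm B"
      by (meson mult_right_mono norm_ge_zero norm_mult_ineq order_trans)
    also have "\<dots> \<le> 1 * norm Y * 1"
      using that by (intro mult_mono) auto
    finally show ?thesis by simp
  qed
  have "Y * T = T * Y"
  proof (rule orbit_commute[OF posT saS TS ST])
    fix n
    show "norm (T ^ n * Y * S ^ n) \<le> norm Y"
      unfolding orbit_power[OF TYS TU VS] by (rule bound[OF U_pow V_pow])
    show "norm (S ^ n * Y * T ^ n) \<le> norm Y"
      unfolding orbit_power[OF SYT VS[symmetric] TU[symmetric]] by (rule bound[OF V_pow U_pow])
  qed
  then have "Y * N' * (N * M) = N' * (N * Y) * M"
    by (simp only: T_def mult.assoc) (metis mult.assoc)
  also have "\<dots> = N' * Y * (N * M)" by (simp only: comm[symmetric] mult.assoc)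
  finally show ?thesis by (simp add: inv N'_def)
qed

section \<open>The exponential\<close>

definition bexp :: "'a::chilbert_space bop \<Rightarrow> 'a bop" where
  "bexp X = (\<Sum>n. inverse (fact n) *\<^sub>R X ^ n)"

lemma summable_bexp: "summable (\<lambda>n. inverse (fact n) *\<^sub>R (X :: 'a::chilbert_space bop) ^ n)"
proof (rule summable_comparison_test')
  show "summable (\<lambda>n. inverse (fact n) * norm X ^ n)" by (rule summable_exp)
  show "norm (inverse (fact n) *\<^sub>R X ^ n) \<le> inverse (fact n) * norm X ^ n" for n
    by (simp add: mult_left_mono norm_bop_power_le)
qed

lemma ap_power: "ap (X ^ n) = ap X ^^ n"
  by (induction n) (auto simp: fun_eq_iff)

lemma op_exp_ap: "op_exp (ap X) = ap (bexp X)"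
proof
  fix x
  have "ap (bexp X) x = (\<Sum>n. ap (inverse (fact n) *\<^sub>R X ^ n) x)"
    unfolding bexp_def
    by (rule bounded_linear.suminf[OF bounded_bilinear.bounded_linear_left[OF bounded_bilinear_ap] summable_bexp])
  then show "op_exp (ap X) x = ap (bexp X) x"
    by (simp add: op_exp_def ap_power)
qed

lemma bexp_commute:
  assumes "W * X = X * W"
  shows "W * bexp X = bexp X * W"
proof -
  have "W * X ^ n = X ^ n * W" for n
    using power_commuting_commutes[of X W n] assms by simp
  then have "(\<Sum>n. W * (inverse (fact n) *\<^sub>R X ^ n)) = (\<Sum>n. (inverse (fact n) *\<^sub>R X ^ n) * W)"
    by simp
  then show ?thesis
    unfolding bexp_def
    by (simp only: bounded_linear.suminf[OF bounded_linear_mult_right summable_bexp]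
        bounded_linear.suminf[OF bounded_linear_mult_left summable_bexp])
qed

lemma apx_power: "apx X c x \<Longrightarrow> apx (X ^ n) (c ^ n) x"
proof (induction n)
  case 0
  show ?case using apx_scaleR_one[of 1] by simp
next
  case (Suc n)
  then show ?case using apx_mult[of X c x "X ^ n" "c ^ n"] by simp
qed

lemma apx_bexp:
  assumes "unit_seq x" "apx X c x"
  shows "apx (bexp X) (exp c) x"
proof (rule apx_lim[OF assms(1)])
  show "(\<lambda>k. \<Sum>n<k. inverse (fact n) *\<^sub>R X ^ n) \<longlonglongrightarrow> bexp X"
    unfolding bexp_def by (rule summable_LIMSEQ[OF summable_bexp])
  show "(\<lambda>k. \<Sum>n<k. c ^ n /\<^sub>R fact n) \<longlonglongrightarrow> exp c"
    using exp_converges[of c] by (simp only: sums_def)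
  show "apx (\<Sum>n<k. inverse (fact n) *\<^sub>R X ^ n) (\<Sum>n<k. c ^ n /\<^sub>R fact n) x" for k
  proof (induction k)
    case 0
    show ?case using apx_scaleR_one[of 0] by simp
  next
    case (Suc k)
    have "apx (inverse (fact k) *\<^sub>R X ^ k) (c ^ k /\<^sub>R fact k) x"
      using apx_scaleR[OF apx_power[OF assms(2)], of "inverse (fact k)" k] by (simp add: scaleR_conv_of_real)
    with Suc show ?case by (simp add: apx_add)
  qed
qed

text \<open>Normality results from commuting twice: \<open>star (bexp X)\<close> commutes with
  \<open>X\<close>, hence with the series in \<open>X\<close>.\<close>

lemma bexp_commute_normal:
  assumes "normal X"
  shows "X * bexp X = bexp X * X" "star X * bexp X = bexp X * star X"
    "X * star (bexp X) = star (bexp X) * X" "normal (bexp X)"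
proof -
  show 1: "X * bexp X = bexp X * X" by (rule bexp_commute) simp
  show 2: "star X * bexp X = bexp X * star X"
    using assms by (intro bexp_commute) (simp add: normal_def)
  show 3: "X * star (bexp X) = star (bexp X) * X"
    using arg_cong[OF 2, of star] by simp
  show "normal (bexp X)"
    unfolding normal_def by (rule bexp_commute) (simp add: 3)
qed

text \<open>Converse of \<open>apx_bexp\<close>. The operator \<open>X\<close> need not settle along
  \<open>z\<close>, so a new sequence is chosen on which \<open>X\<close> and \<open>bexp X\<close>
  have approximate eigenvalues together.\<close>

lemma apx_bexp_exp:
  assumes "normal X" "unit_seq z" "apx (bexp X) c z"
  obtains x l where "unit_seq x" "apx X l x" "c = exp l"
proof -
  let ?D = "bexp X - scal c"
  have "joint {?D}"
    unfolding joint_def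
  proof (intro allI impI)
    fix e :: real assume "0 < e"
    from LIMSEQ_D[OF assms(3)[unfolded apx_def] this]
    obtain n where "norm (ap ?D (z n)) < e" by auto
    then show "\<exists>u. norm u = 1 \<and> (\<forall>D\<in>{?D}. norm (ap D u) < e)"
      using assms(2) unfolding unit_seq_def by (intro exI[of _ "z n"]) simp
  qed
  moreover have "D * X = X * D" "D * star X = star X * D" if "D \<in> {?D}" for D
    using that bexp_commute_normal(1,2)[OF assms(1)] scal_commute[of X c] scal_commute[of "star X" c]
    by (simp_all add: left_diff_distrib right_diff_distrib)
  ultimately have "\<exists>x l. unit_seq x \<and> (\<forall>D\<in>{?D}. (\<lambda>n. ap D (x n)) \<longlonglongrightarrow> 0) \<and> apx X l x"
    by (intro joint_normal assms(1))
  then obtain x l where x: "unit_seq x" "apx X l x" and "apx (bexp X) c x"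
    by (auto simp only: apx_def)
  then have "c = exp l" using apx_unique apx_bexp by blast
  then show thesis using that x by blast
qed

text \<open>The enclosing set is compact and misses 0, which is what continuity of
  \<open>sq_log\<close> and of the reciprocal requires.\<close>

lemma approx_spectrum_bexp:
  assumes "normal X"
  shows "approx_spectrum_in (bexp X) (exp ` cball 0 (norm X))"
  unfolding approx_spectrum_in_def
proof (intro allI impI)
  fix z c assume "unit_seq z" "apx (bexp X) c z"
  then obtain x l where "unit_seq x" "apx X l x" "c = exp l"
    using apx_bexp_exp[OF assms] by blast
  moreover from this have "l \<in> cball 0 (norm X)" using apx_norm_le by simp
  ultimately show "c \<in> exp ` cball 0 (norm X)" by blast
qed

lemma compact_exp_cball: "compact (exp ` cball 0 r :: complex set)"
  by (intro compact_continuous_image continuous_intros compact_cball)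

text \<open>The inverse is \<open>star N\<close> divided by the squared modulus of \<open>N\<close>,
  obtained from the calculus; no product formula for exponentials enters.\<close>

lemma bexp_invertible:
  assumes "normal X"
  obtains M where "M * bexp X = 1" "bexp X * M = 1"
proof -
  define N where "N = bexp X"
  have N: "normal N" unfolding N_def by (rule bexp_commute_normal(4)[OF assms])
  define K where "K = (exp ` cball 0 (norm X) :: complex set)"
  have K: "approx_spectrum_in N K"
    unfolding N_def K_def by (rule approx_spectrum_bexp[OF assms])
  have nz: "0 \<notin> K" by (auto simp: K_def)
  have "continuous_on K (\<lambda>c. 1 / (cmod c)\<^sup>2)"
    using nz by (intro continuous_intros) auto
  then obtain G where G: "fcalc N (\<lambda>c. 1 / (cmod c)\<^sup>2) G"
    using fcalc_exists[OF N K] compact_exp_cball unfolding K_def by blast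
  have abs: "fcalc N (\<lambda>c. (cmod c)\<^sup>2) (star N * N)"
    unfolding fcalc_def
  proof (intro conjI allI impI)
    show "W * (star N * N) = star N * N * W" if "W * N = N * W" "W * star N = star N * W" for W
      using that by (metis mult.assoc)
    show "apx (star N * N) (of_real ((cmod c)\<^sup>2)) x" if "unit_seq x" "apx N c x" for x c
      using apx_mult[OF apx_star[OF N that(2)] that(2)] by (simp only: complex_norm_square mult.commute)
  qed simp
  have GN: "G * (star N * N) = 1 *\<^sub>R 1"
    by (rule fcalc_unique[OF N fcalc_mult[OF N G abs] fcalc_const K]) (use nz in auto)
  moreover have "N * (G * star N) = G * (star N * N)"
    using fcalc_commute_base[OF N G] N unfolding normal_def by (metis mult.assoc)
  ultimately show thesis
    by (intro that[of "G * star N"]) (simp_all add: N_def mult.assoc)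
qed

section \<open>The squared modulus of the logarithm\<close>

text \<open>On the strip \<open>\<bar>Im l\<bar> \<le> pi\<close> the number \<open>(cmod l)\<^sup>2\<close> is a continuous function of \<open>exp l\<close>,
  although \<open>l\<close> itself is not: \<open>arccos\<close> only recovers \<open>\<bar>Im l\<bar>\<close>.\<close>

definition sq_log :: "complex \<Rightarrow> real" where
  "sq_log c = (ln (cmod c))\<^sup>2 + (arccos (Re c / cmod c))\<^sup>2"

lemma sq_log_exp:
  assumes "l \<in> strip_S"
  shows "sq_log (exp l) = (cmod l)\<^sup>2"
proof -
  have "arccos (cos (Im l)) = \<bar>Im l\<bar>"
    using assms arccos_cos[of "\<bar>Im l\<bar>"] by (simp add: strip_S_def abs_le_iff)
  then show ?thesis
    by (simp add: sq_log_def Re_exp cmod_power2)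
qed

lemma continuous_on_sq_log: "0 \<notin> K \<Longrightarrow> continuous_on K sq_log"
proof -
  have "- cmod c \<le> Re c" for c
    using abs_Re_le_cmod[of c] by linarith
  moreover assume "0 \<notin> K"
  ultimately show ?thesis
    unfolding sq_log_def by (intro continuous_intros) (auto simp: divide_simps complex_Re_le_cmod)
qed

text \<open>The comparison runs over approximate eigenvectors of \<open>X\<close>, not of
  \<open>bexp X\<close>: there the value \<open>l\<close> is known to lie in the strip, and both
  operators take the value \<open>(cmod l)\<^sup>2\<close>.\<close>

lemma sq_log_bexp:
  assumes N: "normal X" and S: "approx_spectrum_in X strip_S" and F: "fcalc (bexp X) sq_log F"
  shows "star X * X = F"
proof -
  have xx: "star X * X = X * star X" using N by (simp add: normal_def)
  have "norm (F - star X * X) \<le> 0"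
  proof (rule norm_le_joint[OF _ N])
    show "star (F - star X * X) = F - star X * X"
      using fcalc_self_adjoint[OF F] by simp
    have "X * F = F * X"
      by (rule fcalc_commute[OF F]) (rule bexp_commute_normal[OF N])+
    moreover have "X * (star X * X) = star X * X * X" by (simp only: xx mult.assoc)
    ultimately show "(F - star X * X) * X = X * (F - star X * X)"
      by (simp only: left_diff_distrib right_diff_distrib)
    fix x t l assume x: "unit_seq x" "apx (F - star X * X) (complex_of_real t) x" "apx X l x"
    have l: "l \<in> strip_S" using S x by (auto simp: approx_spectrum_in_def)
    have "apx F (of_real ((cmod l)\<^sup>2)) x"
      using fcalc_apx[OF F x(1) apx_bexp[OF x(1,3)]] by (simp only: sq_log_exp[OF l])
    moreover have "apx (star X * X) (of_real ((cmod l)\<^sup>2)) x"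
      using apx_mult[OF apx_star[OF N x(3)] x(3)] by (simp only: complex_norm_square mult.commute)
    ultimately have "apx (F - star X * X) 0 x"
      using apx_diff by fastforce
    then have "complex_of_real t = 0" using apx_unique x by blast
    then show "\<bar>t\<bar> \<le> 0" by simp
  qed simp
  then show ?thesis by simp
qed

section \<open>Translation between functions and bundled operators\<close>

lemma op_spectrum_apx:
  assumes "unit_seq x" "apx T c x"
  shows "c \<in> op_spectrum (ap T)"
proof (rule ccontr)
  assume "c \<notin> op_spectrum (ap T)"
  then obtain f where "bounded_op f" and id: "f \<circ> (\<lambda>x. ap T x - cscale c x) = id"
    unfolding op_spectrum_def by blast
  then obtain S where S: "f = ap S" using bounded_op_cases by blast
  \<comment> \<open>A bounded left inverse would turn the vanishing images back into the unit
    vectors \<open>x n\<close>, forcing these to tend to 0.\<close>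
  have "ap S (ap (T - scal c) v) = v" for v
    using fun_cong[OF id, of v] by (simp add: S)
  moreover have "(\<lambda>n. ap S (ap (T - scal c) (x n))) \<longlonglongrightarrow> 0"
    by (rule tendsto_ap_zero[OF assms(2)[unfolded apx_def]])
  ultimately have "x \<longlonglongrightarrow> 0" by simp
  then have "(\<lambda>n. norm (x n)) \<longlonglongrightarrow> 0" by (rule tendsto_norm_zero)
  then show False using assms(1) by (simp add: unit_seq_def LIMSEQ_const_iff)
qed

lemma normal_op_ap: "normal_op (ap T) \<longleftrightarrow> normal T"
proof -
  have "normal_op (ap T) \<longleftrightarrow> (\<forall>x. ap (T * star T) x = ap (star T * T) x)"
    by (simp add: normal_op_def bounded_op_ap ap_star[symmetric] fun_eq_iff)
  also have "\<dots> \<longleftrightarrow> T * star T = star T * T"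
    by (metis bop_eqI)
  finally show ?thesis by (auto simp: normal_def)
qed

text \<open>Existence and uniqueness of positive roots make the description in
  \<open>op_modulus\<close> proper.\<close>

lemma op_modulus_ap:
  obtains R where "op_modulus (ap T) = ap R" "positive_op (ap R)" "R * R = star T * T"
proof -
  obtain R where R: "positive_op (ap R)" "R * R = star T * T"
    using positive_root_exists[OF positive_star_mult] by blast
  have "op_modulus (ap T) = ap R"
    unfolding op_modulus_def
  proof (rule the_equality)
    have "ap (R * R) x = ap (star T * T) x" for x by (simp only: R)
    then show "positive_op (ap R) \<and> ap R \<circ> ap R = adjoint (ap T) \<circ> ap T"
      using R(1) by (auto simp: fun_eq_iff ap_star[symmetric])
  next
    fix f assume f: "positive_op f \<and> f \<circ> f = adjoint (ap T) \<circ> ap T"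
    then obtain R' where R': "f = ap R'"
      using bounded_op_cases positive_op_def by metis
    have "R' * R' = star T * T"
      by (rule bop_eqI) (use f R' in \<open>auto simp: fun_eq_iff ap_star[symmetric]\<close>)
    then have "R' = R"
      using positive_root_unique[of R' R] f R R' by simp
    then show "f = ap R" using R' by simp
  qed
  then show thesis using that R by blast
qed

theorem theorem3p1:
  fixes X Y :: "'a::chilbert_space \<Rightarrow> 'a"
  assumes "normal_op X"
    and "op_spectrum X \<subseteq> strip_S"
    and "bounded_op Y"
    and "op_exp X = op_exp Y"
  shows "(normal_op Y \<and> op_spectrum Y \<subseteq> strip_S \<longrightarrow> op_modulus X = op_modulus Y)
         \<and> op_modulus X \<circ> Y = Y \<circ> op_modulus X"
proof -
  have "bounded_op X" using assms(1) by (simp add: normal_op_def)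
  then obtain A where A: "X = ap A" by (rule bounded_op_cases)
  obtain B where B: "Y = ap B" by (rule bounded_op_cases[OF assms(3)])
  have nA: "normal A" using assms(1) by (simp add: A normal_op_ap)
  have strip: "approx_spectrum_in T strip_S" if "op_spectrum (ap T) \<subseteq> strip_S" for T :: "'a bop"
    using that op_spectrum_apx by (auto simp: approx_spectrum_in_def)
  define N where "N = bexp A"
  have NB: "N = bexp B"
    using assms(4) by (intro bop_eqI) (simp add: A B op_exp_ap N_def)
  have nN: "normal N" unfolding N_def by (rule bexp_commute_normal(4)[OF nA])
  have "0 \<notin> (exp ` cball 0 (norm A) :: complex set)" by auto
  then obtain F where F: "fcalc N sq_log F"
    using fcalc_exists[OF nN approx_spectrum_bexp[OF nA, folded N_def] compact_exp_cball]
      continuous_on_sq_log by blast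
  have FA: "star A * A = F"
    using sq_log_bexp[OF nA strip] F assms(2) by (simp add: A N_def)
  obtain R where R: "op_modulus X = ap R" "positive_op (ap R)" "R * R = star A * A"
    unfolding A by (rule op_modulus_ap)
  have "op_modulus X = op_modulus Y" if "normal_op Y" "op_spectrum Y \<subseteq> strip_S"
  proof -
    \<comment> \<open>\<open>F\<close> was built from \<open>A\<close>, but its defining relation
      mentions only \<open>N\<close>, which is also the exponential of \<open>B\<close>.\<close>
    have "star B * B = F"
      using sq_log_bexp[of B F] strip that F by (simp add: B NB normal_op_ap)
    moreover obtain R' where R': "op_modulus Y = ap R'" "positive_op (ap R')" "R' * R' = star B * B"
      unfolding B by (rule op_modulus_ap)
    ultimately show ?thesis
      using positive_root_unique[OF R(2) R'(2)] R(1,3) R'(1,3) FA by simp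
  qed
  moreover have "op_modulus X \<circ> Y = Y \<circ> op_modulus X"
  proof -
    have BN: "B * N = N * B" unfolding NB by (rule bexp_commute) simp
    obtain M where "M * N = 1" "N * M = 1"
      unfolding N_def by (rule bexp_invertible[OF nA])
    \<comment> \<open>Fuglede supplies the second commutation that \<open>fcalc_commute\<close> asks
      for.\<close>
    then have "B * star N = star N * B" by (rule fuglede_invertible[OF nN _ _ BN])
    then have "B * (R * R) = R * R * B"
      unfolding R(3) FA by (rule fcalc_commute[OF F BN])
    then have "B * R = R * B" by (rule positive_root_commute[OF R(2)])
    then have "ap (B * R) x = ap (R * B) x" for x by simp
    then show ?thesis by (simp add: R(1) B fun_eq_iff)
  qed
  ultimately show ?thesis by blast
qed

end
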